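(* Let $q$ be a unimodular complex number and let $V_1$ and $V_2$ be two bounded operators acting on a Hilbert space $\mathcal H$. Then the following are equivalent. (i) ($q$-commutativity) $(V_1,V_2)$ is a $q$-commutative pair of isometries. (ii) (BCL-1 $q$-model) There exist Hilbert spaces $\mathcal F$ and $\mathcal K_u$, a projection $P$ and a unitary $U$ in $\mathcal B(\mathcal F)$, and a pair $(W_1,W_2)$ of $q$-commuting unitaries in $\mathcal B(\mathcal K_u)$ such that $(V_1,V_2)$ is unitarily equivalent to $$\left(\begin{bmatrix}R_q\otimes P^\perp U + M_zR_q\otimes P U &0\\0& W_1\end{bmatrix},\ \begin{bmatrix}R_{\overline q}\otimes U^*P+R_{\overline q}M_z\otimes U^*P^\perp& 0\\0&W_2\end{bmatrix}\right)\quad\text{on }\begin{bmatrix}H^2\otimes \mathcal F\\ \mathcal K_u\end{bmatrix}.$$ Moreover, the tuple $(\mathcal F,\mathcal K_u;P,U,W_1,W_2)$ can be chosen to be such that $$\mathcal F=\begin{bmatrix}\mathcal D_{V_1^*}\\ \mathcal D_{V_2^*}\end{bmatrix},\quad \mathcal K_u=\bigcap_{n\ge 0}(V_1V_2)^n\mathcal H,\quad P:\begin{bmatrix}f\\ g\end{bmatrix}\mapsto\begin{bmatrix}f\\ 0\end{bmatrix},$$ $$U:\begin{bmatrix}D_{V_1^*}\\ D_{V_2^*}V_1^*\end{bmatrix}h\mapsto\begin{bmatrix}D_{V_1^*}V_2^*\\ D_{V_2^*}\end{bmatrix}h\ (h\in\mathcal H),\quad (W_1,W_2)=(V_1,V_2)|_{\mathcal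 K_u},$$ and the unitary operator $\tau_{\rm BCL}:\mathcal H\to\begin{bmatrix}H^2\otimes \mathcal F\\ \mathcal K_u\end{bmatrix}$ implementing the equivalence can be chosen to be such that $$\tau_{\rm BCL} h= \begin{bmatrix}D_{V_1^*}\\ D_{V_2^*}V_1^*\end{bmatrix}(I-zV^* )^{-1}h\ \oplus\ \lim_{n\to\infty}(V_1V_2)^n(V_2^*V_1^* )^n h,\qquad V:=V_1V_2.$$ (iii) (BCL-2 $q$-model) There exist Hilbert spaces $\mathcal F_\dag$ and $\mathcal K_{u\dag}$, a projection $P_\dag$ and a unitary $U_\dag$ in $\mathcal B(\mathcal F_\dag)$, and a pair $(W_{1\dag},W_{2\dag})$ of $q$-commuting unitaries in $\mathcal B(\mathcal K_{u\dag})$ such that $(V_1,V_2)$ is unitarily equivalent to $$\left(\begin{bmatrix}R_q\otimes U_\dag^*P_\dag^\perp + M_zR_q\otimes U_\dag^*P_\dag&0\\0&W_{1\dag}\end{bmatrix},\ \begin{bmatrix}R_{\overline q}\otimes P_\dag U_\dag+R_{\overline q}M_z\otimes P_\dag^\perp U_\dag&0\\0&W_{2\dag}\end{bmatrix}\right)\quad\text{on }\begin{bmatrix}H^2\otimes \mathcal F_\dag\\ \mathcal K_{u\dag}\end{bmatrix}.$$ Moreover, the tuple can be chosen to be such that $(\mathcal F_\dag,\mathcal K_{u\dag};P_\dag,U_\dag,W_{1\dag},W_{2\dag})=(\mathcal F,\mathcal K_u;P,U^*,W_1,W_2)$, where $(\mathcal F,\mathcal K_u;P,U,W_1,W_2)$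 is the explicit tuple displayed in (ii), and the unitary operator $\tau_\dag:\mathcal H\to\begin{bmatrix}H^2\otimes \mathcal F_\dag\\ \mathcal K_{u\dag}\end{bmatrix}$ implementing the equivalence can be chosen to be given by the same formula as $\tau_{\rm BCL}$ in (ii), that is, $$\tau_{\dag} h= \begin{bmatrix}D_{V_1^*}\\ D_{V_2^*}V_1^*\end{bmatrix}(I-zV^* )^{-1}h\ \oplus\ \lim_{n\to\infty}(V_1V_2)^n(V_2^*V_1^* )^n h.$$
   Context: A pair $(A,B)$ of operators is $q$-commutative (the operators are $q$-commuting) if $AB=qBA$. Two pairs $(A_1,A_2)$ on $\mathcal H$ and $(B_1,B_2)$ on $\mathcal K$ are (jointly) unitarily equivalent if there is a unitary $\tau:\mathcal H\to\mathcal K$ with $\tau A_j=B_j\tau$ for $j=1,2$. $\mathcal B(\mathcal H)$ denotes the bounded operators on $\mathcal H$. For a contraction $T$, $D_T=(I-T^*T)^{1/2}$ and $\mathcal D_T=\overline{\operatorname{Ran}}\,D_T$ (so $D_{T^*}=(I-TT^* )^{1/2}$, $\mathcal D_{T^*}=\overline{\operatorname{Ran}}\,D_{T^*}$). Column notation $\begin{bmatrix}\mathcal A\\ \mathcal B\end{bmatrix}$ denotes the Hilbert space direct sum $\mathcal A\oplus\mathcal B$. "Projection" means orthogonal projection, and $P^\perp=I-P$. $H^2$ is the Hardy space of the unit disk; $M_z$ is multiplication by $z$ on $H^2$; for unimodular $q$, $R_q$ is the unitary on $H^2$ given by $(R_qf)(z)=f(qz)$. $H^2\otimes\mathcal F$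 is identified with the $\mathcal F$-valued Hardy space $H^2(\mathcal F)$. For an operator $A:\mathcal H\to\mathcal F$, $A(I-zV^* )^{-1}h$ denotes the element $\sum_{n\ge0}z^nAV^{*n}h$ of $H^2(\mathcal F)$.
   Formalization: In (iii), the tuple (P,U* ) and τ†=τ_BCL cannot in general be chosen together (they force PU=UP); proved instead: (P,U* ) works with τ†=((I⊗U)⊕I)τ_BCL, and τ†=τ_BCL works with P†=U*PU, U†=U*. *)

theory Defs
  imports "HOL-Analysis.Analysis"
begin

section \<open>Complex Hilbert spaces\<close>

text \<open>
  A Hilbert space is either a whole type of the class below or a closed complex subspace of
  such a type. The inner product is linear in its first argument.
\<close>

class chilbert_space = banach +
  fixes scaleC :: "complex \<Rightarrow> 'a \<Rightarrow> 'a" (infixr "*\<^sub>C" 75)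
    and cinner :: "'a \<Rightarrow> 'a \<Rightarrow> complex"
  assumes scaleC_add_right: "c *\<^sub>C (x + y) = c *\<^sub>C x + c *\<^sub>C y"
    and scaleC_add_left: "(c + d) *\<^sub>C x = c *\<^sub>C x + d *\<^sub>C x"
    and scaleC_scaleC: "c *\<^sub>C (d *\<^sub>C x) = (c * d) *\<^sub>C x"
    and scaleC_of_real: "complex_of_real r *\<^sub>C x = r *\<^sub>R x"
    and cinner_commute: "cinner x y = cnj (cinner y x)"
    and cinner_add_left: "cinner (x + y) z = cinner x z + cinner y z"
    and cinner_scaleC_left: "cinner (c *\<^sub>C x) y = c * cinner x y"
    and cinner_self: "cinner x x = complex_of_real ((norm x)\<^sup>2)"

instantiation complex :: chilbert_space
begin

definition scaleC_complex :: "complex \<Rightarrow> complex \<Rightarrow> complex" where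
  "scaleC_complex c x = c * x"

definition cinner_complex :: "complex \<Rightarrow> complex \<Rightarrow> complex" where
  "cinner_complex x y = x * cnj y"

instance
  by standard
    (simp_all add: scaleC_complex_def cinner_complex_def algebra_simps scaleR_conv_of_real
      complex_mult_cnj cmod_def)

end

text \<open>The norm of the product type in the library is already the norm of the Hilbert space direct sum.\<close>

instantiation prod :: (chilbert_space, chilbert_space) chilbert_space
begin

definition scaleC_prod :: "complex \<Rightarrow> 'a \<times> 'b \<Rightarrow> 'a \<times> 'b" where
  "scaleC_prod c x = (c *\<^sub>C fst x, c *\<^sub>C snd x)"

definition cinner_prod :: "'a \<times> 'b \<Rightarrow> 'a \<times> 'b \<Rightarrow> complex" where
  "cinner_prod x y = cinner (fst x) (fst y) + cinner (snd x) (snd y)"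

instance
proof
  fix x y :: "'a \<times> 'b"
  show "cinner x y = cnj (cinner y x)"
    using cinner_commute[of "fst x" "fst y"] cinner_commute[of "snd x" "snd y"]
    by (simp add: cinner_prod_def)
qed (simp_all add: scaleC_prod_def cinner_prod_def prod_eq_iff scaleC_add_right scaleC_add_left
      scaleC_scaleC scaleC_of_real cinner_add_left cinner_scaleC_left cinner_self norm_prod_def
      algebra_simps)

end

lemma cinner_0_left [simp]: "cinner 0 (y::'a::chilbert_space) = 0"
  using cinner_add_left[of "0::'a" 0 y] by simp

lemma cinner_self_eq_0: "cinner x x = 0 \<longleftrightarrow> x = (0::'a::chilbert_space)"
  by (simp add: cinner_self)

lemma cinner_diff_left: "cinner (x - y) z = cinner x z - cinner y (z::'a::chilbert_space)"
  using cinner_add_left[of "x - y" y z] by (simp add: algebra_simps)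

lemma cinner_diff_right: "cinner z (x - y) = cinner z x - cinner z (y::'a::chilbert_space)"
  by (metis cinner_commute cinner_diff_left complex_cnj_diff)

definition closed_csubspace :: "'a::chilbert_space set \<Rightarrow> bool" where
  "closed_csubspace S \<longleftrightarrow>
     0 \<in> S \<and> (\<forall>x\<in>S. \<forall>y\<in>S. x + y \<in> S) \<and> (\<forall>c. \<forall>x\<in>S. c *\<^sub>C x \<in> S) \<and> closed S"

section \<open>Operators\<close>

text \<open>
  An operator on the Hilbert space \<open>S\<close> is represented by a function on the ambient type, of which
  only the values on \<open>S\<close> matter.
\<close>

definition bounded_op :: "'a::chilbert_space set \<Rightarrow> ('a \<Rightarrow> 'a) \<Rightarrow> bool" where
  "bounded_op S A \<longleftrightarrow>
     A ` S \<subseteq> S \<and>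
     (\<forall>x\<in>S. \<forall>y\<in>S. A (x + y) = A x + A y) \<and>
     (\<forall>c. \<forall>x\<in>S. A (c *\<^sub>C x) = c *\<^sub>C A x) \<and>
     (\<exists>B. \<forall>x\<in>S. norm (A x) \<le> B * norm x)"

definition adj_on :: "'a::chilbert_space set \<Rightarrow> ('a \<Rightarrow> 'a) \<Rightarrow> 'a \<Rightarrow> 'a" where
  "adj_on S A y = (THE x. x \<in> S \<and> (\<forall>u\<in>S. cinner (A u) y = cinner u x))"

lemma adj_on_eqI:
  assumes S: "closed_csubspace S" and x: "x \<in> S" and eq: "\<And>u. u \<in> S \<Longrightarrow> cinner (A u) y = cinner u x"
  shows "adj_on S A y = x"
  unfolding adj_on_def
proof (rule the_equality)
  show "x \<in> S \<and> (\<forall>u\<in>S. cinner (A u) y = cinner u x)"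
    using x eq by blast
next
  fix w assume w: "w \<in> S \<and> (\<forall>u\<in>S. cinner (A u) y = cinner u w)"
  have "(-1) *\<^sub>C x = - x"
    using scaleC_of_real[of "-1" x] by simp
  then have "- x \<in> S"
    using S x unfolding closed_csubspace_def by metis
  then have "w + - x \<in> S"
    using S w unfolding closed_csubspace_def by blast
  then have "cinner (w - x) (w - x) = 0"
    using w eq[of "w - x"] by (simp add: cinner_diff_right)
  then show "w = x"
    by (simp add: cinner_self_eq_0)
qed

abbreviation cadj :: "('a::chilbert_space \<Rightarrow> 'a) \<Rightarrow> 'a \<Rightarrow> 'a" where
  "cadj \<equiv> adj_on UNIV"

definition isometry_on :: "'a::chilbert_space set \<Rightarrow> ('a \<Rightarrow> 'a) \<Rightarrow> bool" where
  "isometry_on S A \<longleftrightarrow> bounded_op S A \<and> (\<forall>x\<in>S. norm (A x) = norm x)"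

definition unitary_on :: "'a::chilbert_space set \<Rightarrow> ('a \<Rightarrow> 'a) \<Rightarrow> bool" where
  "unitary_on S A \<longleftrightarrow> bounded_op S A \<and> A ` S = S \<and> (\<forall>x\<in>S. \<forall>y\<in>S. cinner (A x) (A y) = cinner x y)"

definition projection_on :: "'a::chilbert_space set \<Rightarrow> ('a \<Rightarrow> 'a) \<Rightarrow> bool" where
  "projection_on S P \<longleftrightarrow>
     bounded_op S P \<and> (\<forall>x\<in>S. P (P x) = P x) \<and> (\<forall>x\<in>S. \<forall>y\<in>S. cinner (P x) y = cinner x (P y))"

definition perp :: "('a::chilbert_space \<Rightarrow> 'a) \<Rightarrow> 'a \<Rightarrow> 'a" where
  "perp P x = x - P x"

definition q_commuting_on ::
  "'a::chilbert_space set \<Rightarrow> complex \<Rightarrow> ('a \<Rightarrow> 'a) \<Rightarrow> ('a \<Rightarrow> 'a) \<Rightarrow> bool" where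
  "q_commuting_on S q A B \<longleftrightarrow> (\<forall>x\<in>S. A (B x) = q *\<^sub>C B (A x))"

definition q_isometric_pair :: "complex \<Rightarrow> ('a::chilbert_space \<Rightarrow> 'a) \<Rightarrow> ('a \<Rightarrow> 'a) \<Rightarrow> bool" where
  "q_isometric_pair q A B \<longleftrightarrow> isometry_on UNIV A \<and> isometry_on UNIV B \<and> q_commuting_on UNIV q A B"

definition positive_op :: "('a::chilbert_space \<Rightarrow> 'a) \<Rightarrow> bool" where
  "positive_op A \<longleftrightarrow> bounded_op UNIV A \<and> (\<forall>x. cinner (A x) x \<in> \<real> \<and> 0 \<le> Re (cinner (A x) x))"

definition op_sqrt :: "('a::chilbert_space \<Rightarrow> 'a) \<Rightarrow> 'a \<Rightarrow> 'a" where
  "op_sqrt A = (THE B. positive_op B \<and> B \<circ> B = A)"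

definition defect :: "('a::chilbert_space \<Rightarrow> 'a) \<Rightarrow> 'a \<Rightarrow> 'a" where
  "defect T = op_sqrt (\<lambda>x. x - cadj T (T x))"

definition defect_space :: "('a::chilbert_space \<Rightarrow> 'a) \<Rightarrow> 'a set" where
  "defect_space T = closure (range (defect T))"

section \<open>The vector-valued Hardy space\<close>

text \<open>
  Elements of \<open>hardy F\<close> are functions on the open unit disk with values in \<open>F\<close>; being total
  functions in HOL, they are normalised to vanish off the disk.
\<close>

definition power_series_on_disk :: "(nat \<Rightarrow> 'f) \<Rightarrow> (complex \<Rightarrow> 'f::chilbert_space) \<Rightarrow> bool" where
  "power_series_on_disk a f \<longleftrightarrow> (\<forall>z\<in>ball 0 1. (\<lambda>n. z ^ n *\<^sub>C a n) sums f z)"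

definition hardy :: "'f::chilbert_space set \<Rightarrow> (complex \<Rightarrow> 'f) set" where
  "hardy F = {f. (\<forall>z. z \<notin> ball 0 1 \<longrightarrow> f z = 0) \<and>
     (\<exists>a. range a \<subseteq> F \<and> summable (\<lambda>n. (norm (a n))\<^sup>2) \<and> power_series_on_disk a f)}"

definition taylor_coeff :: "(complex \<Rightarrow> 'f::chilbert_space) \<Rightarrow> nat \<Rightarrow> 'f" where
  "taylor_coeff f = (THE a. power_series_on_disk a f)"

definition hardy_inner :: "(complex \<Rightarrow> 'f::chilbert_space) \<Rightarrow> (complex \<Rightarrow> 'f) \<Rightarrow> complex" where
  "hardy_inner f g = (\<Sum>n. cinner (taylor_coeff f n) (taylor_coeff g n))"

lemma of_real_cmod_power2: "(complex_of_real (cmod c))\<^sup>2 = c * cnj c"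
  by (metis complex_norm_square of_real_power)

lemma norm_scaleC: "norm (c *\<^sub>C x) = cmod c * norm (x::'a::chilbert_space)"
proof -
  have "complex_of_real ((norm (c *\<^sub>C x))\<^sup>2) = c * cnj (cinner (c *\<^sub>C x) x)"
    by (metis cinner_self cinner_scaleC_left cinner_commute)
  also have "\<dots> = c * cnj c * complex_of_real ((norm x)\<^sup>2)"
    by (simp add: cinner_scaleC_left cinner_self)
  also have "\<dots> = complex_of_real ((cmod c * norm x)\<^sup>2)"
    by (simp add: power_mult_distrib of_real_cmod_power2)
  finally have "(norm (c *\<^sub>C x))\<^sup>2 = (cmod c * norm x)\<^sup>2"
    using of_real_eq_iff by blast
  then show ?thesis
    by simp
qed

lemma cinner_Cauchy_Schwarz: "cmod (cinner x y) \<le> norm x * norm (y::'a::chilbert_space)"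
proof (cases "y = 0")
  case True
  then show ?thesis
    using cinner_commute[of x y] by simp
next
  case False
  define b where "b = cinner x y"
  define w where "w = complex_of_real ((norm y)\<^sup>2) *\<^sub>C x - b *\<^sub>C y"
  have wy: "cinner w y = 0"
    by (simp add: w_def b_def cinner_diff_left cinner_scaleC_left cinner_self)
  then have yw: "cinner y w = 0"
    using cinner_commute[of y w] by simp
  have "cinner w x = complex_of_real ((norm y)\<^sup>2) * complex_of_real ((norm x)\<^sup>2) - b * cnj b"
    using cinner_commute[of y x]
    by (simp add: w_def b_def cinner_diff_left cinner_scaleC_left cinner_self)
  then have wx: "cinner w x = complex_of_real ((norm x * norm y)\<^sup>2 - (cmod b)\<^sup>2)"
    by (simp add: power_mult_distrib of_real_cmod_power2 mult.commute)
  have "cinner (complex_of_real ((norm y)\<^sup>2) *\<^sub>C x - b *\<^sub>C y) w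
      = complex_of_real ((norm y)\<^sup>2) * cinner x w"
    by (simp only: cinner_diff_left cinner_scaleC_left yw mult_zero_right diff_zero)
  then have "complex_of_real ((norm w)\<^sup>2) = complex_of_real ((norm y)\<^sup>2) * cinner x w"
    by (simp only: w_def[symmetric] cinner_self)
  also have "\<dots> = complex_of_real ((norm y)\<^sup>2 * ((norm x * norm y)\<^sup>2 - (cmod b)\<^sup>2))"
    using cinner_commute[of x w] wx by simp
  finally have "(norm w)\<^sup>2 = (norm y)\<^sup>2 * ((norm x * norm y)\<^sup>2 - (cmod b)\<^sup>2)"
    using of_real_eq_iff by blast
  then have "0 \<le> (norm y)\<^sup>2 * ((norm x * norm y)\<^sup>2 - (cmod b)\<^sup>2)"
    by (metis zero_le_power2)
  then have "(cmod b)\<^sup>2 \<le> (norm x * norm y)\<^sup>2"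
    using False by (simp add: zero_le_mult_iff)
  then show ?thesis
    unfolding b_def by (rule power2_le_imp_le) simp
qed

lemma bounded_linear_cinner_left: "bounded_linear (\<lambda>x. cinner x (y::'a::chilbert_space))"
proof (rule bounded_linear_intro)
  show "cinner (r *\<^sub>R x) y = r *\<^sub>R cinner x y" for r x
    by (metis scaleC_of_real cinner_scaleC_left scaleR_conv_of_real)
  show "norm (cinner x y) \<le> norm x * norm y" for x
    by (rule cinner_Cauchy_Schwarz)
qed (rule cinner_add_left)

lemma power_series_on_disk_unique:
  fixes f :: "complex \<Rightarrow> 'f::chilbert_space"
  assumes a: "power_series_on_disk a f" and b: "power_series_on_disk b f"
  shows "a = b"
proof
  fix n
  define v where "v = a n - b n"
  define G where "G c = Abs_fps (\<lambda>n. cinner (c n) v)" for c :: "nat \<Rightarrow> 'f"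
  have G: "fps_conv_radius (G c) > 0 \<and> (\<forall>z\<in>ball 0 1. eval_fps (G c) z = cinner (f z) v)"
    if "power_series_on_disk c f" for c
  proof -
    have s: "(\<lambda>n. fps_nth (G c) n * z ^ n) sums cinner (f z) v" if "z \<in> ball 0 1" for z
    proof -
      have "(\<lambda>n. z ^ n *\<^sub>C c n) sums f z"
        using \<open>power_series_on_disk c f\<close> that unfolding power_series_on_disk_def by blast
      from bounded_linear.sums[OF bounded_linear_cinner_left[of v] this] show ?thesis
        by (simp add: G_def cinner_scaleC_left mult.commute)
    qed
    have "summable (\<lambda>n. fps_nth (G c) n * (1/2) ^ n)"
      by (rule sums_summable[OF s]) simp
    then have "fps_conv_radius (G c) \<ge> norm (1/2::complex)"
      unfolding fps_conv_radius_def by (rule conv_radius_geI)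
    moreover have "(0::ereal) < ereal (norm (1/2::complex))"
      by simp
    ultimately have "fps_conv_radius (G c) > 0"
      using less_le_trans by blast
    then show ?thesis
      using s unfolding eval_fps_def sums_iff by blast
  qed
  have "eventually (\<lambda>z. z \<in> ball 0 1) (nhds (0::complex))"
    by (rule eventually_nhds_in_open) auto
  then have "eventually (\<lambda>z. eval_fps (G a) z = eval_fps (G b) z) (nhds 0)"
    by eventually_elim (use G[OF a] G[OF b] in auto)
  then have "G a = G b"
    using G[OF a] G[OF b] by (intro eval_fps_eqD) auto
  then have "fps_nth (G a) n = fps_nth (G b) n"
    by simp
  then have "cinner v v = 0"
    by (simp add: G_def v_def cinner_diff_left)
  then show "a n = b n"
    by (simp add: cinner_self_eq_0 v_def)
qed

lemma taylor_coeff_eqI: "power_series_on_disk a f \<Longrightarrow> taylor_coeff f = a"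
  unfolding taylor_coeff_def using power_series_on_disk_unique by blast

section \<open>Operators on the Hardy space\<close>

definition M_z :: "(complex \<Rightarrow> 'f::chilbert_space) \<Rightarrow> complex \<Rightarrow> 'f" where
  "M_z f = (\<lambda>z. z *\<^sub>C f z)"

definition R_rot :: "complex \<Rightarrow> (complex \<Rightarrow> 'f::chilbert_space) \<Rightarrow> complex \<Rightarrow> 'f" where
  "R_rot q f = (\<lambda>z. f (q * z))"

text \<open>
  Under the identification of \<open>H\<^sup>2 \<otimes> F\<close> with the \<open>F\<close>-valued Hardy space, in which \<open>f \<otimes> v\<close> is the
  function \<open>z \<mapsto> f z *\<^sub>C v\<close>, the operator \<open>I \<otimes> A\<close> applies \<open>A\<close> pointwise. The first factor \<open>X\<close> is only
  ever a product of \<open>M_z\<close> and \<open>R_rot q\<close>; these are given by the same formula on \<open>H\<^sup>2\<close> and on its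
  \<open>F\<close>-valued version, so \<open>X \<otimes> A = (X \<otimes> I) (I \<otimes> A)\<close> is as follows.
\<close>

definition tensor_op ::
  "((complex \<Rightarrow> 'f) \<Rightarrow> complex \<Rightarrow> 'f) \<Rightarrow> ('f \<Rightarrow> 'f) \<Rightarrow> (complex \<Rightarrow> 'f) \<Rightarrow> complex \<Rightarrow> 'f::chilbert_space"
    (infixr "\<otimes>\<^sub>H" 70) where
  "(X \<otimes>\<^sub>H A) f = X (\<lambda>z. A (f z))"

lemma tensor_op_elementary:
  fixes f :: "complex \<Rightarrow> complex"
  assumes "\<And>c. A (c *\<^sub>C v) = c *\<^sub>C A v"
  shows "(M_z \<otimes>\<^sub>H A) (\<lambda>z. f z *\<^sub>C v) = (\<lambda>z. M_z f z *\<^sub>C A v)"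
    and "(R_rot q \<otimes>\<^sub>H A) (\<lambda>z. f z *\<^sub>C v) = (\<lambda>z. R_rot q f z *\<^sub>C A v)"
    and "((M_z \<circ> R_rot q) \<otimes>\<^sub>H A) (\<lambda>z. f z *\<^sub>C v) = (\<lambda>z. (M_z \<circ> R_rot q) f z *\<^sub>C A v)"
    and "((R_rot q \<circ> M_z) \<otimes>\<^sub>H A) (\<lambda>z. f z *\<^sub>C v) = (\<lambda>z. (R_rot q \<circ> M_z) f z *\<^sub>C A v)"
  using assms by (simp_all add: tensor_op_def M_z_def R_rot_def scaleC_complex_def scaleC_scaleC)

definition op_add ::
  "((complex \<Rightarrow> 'f) \<Rightarrow> complex \<Rightarrow> 'f) \<Rightarrow> ((complex \<Rightarrow> 'f) \<Rightarrow> complex \<Rightarrow> 'f)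
    \<Rightarrow> (complex \<Rightarrow> 'f) \<Rightarrow> complex \<Rightarrow> 'f::chilbert_space" (infixl "\<oplus>\<^sub>H" 65) where
  "(X \<oplus>\<^sub>H Y) f = (\<lambda>z. X f z + Y f z)"

section \<open>The models\<close>

text \<open>
  The spaces \<open>F\<close> and \<open>K\<close> of a model are closed subspaces of types \<open>'f\<close> and \<open>'k\<close>, which cannot be
  quantified existentially. For operators on \<open>'a\<close>, existence of a model is to be understood with
  \<open>'f = 'a \<times> 'a\<close> and \<open>'k = 'a\<close>; this loses nothing, as the spaces of any model embed in \<open>'a\<close>. In
  consequences drawn from a model, \<open>'f\<close> and \<open>'k\<close> are arbitrary.
\<close>

text \<open>The Hilbert space direct sum of \<open>hardy F\<close> and \<open>K\<close> is \<open>hardy F \<times> K\<close>.\<close>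

definition model_unitary ::
  "'f::chilbert_space set \<Rightarrow> 'k::chilbert_space set \<Rightarrow> ('a::chilbert_space \<Rightarrow> (complex \<Rightarrow> 'f) \<times> 'k) \<Rightarrow> bool" where
  "model_unitary F K \<tau> \<longleftrightarrow>
     range \<tau> = hardy F \<times> K \<and>
     (\<forall>x y. \<tau> (x + y) = (\<lambda>z. fst (\<tau> x) z + fst (\<tau> y) z, snd (\<tau> x) + snd (\<tau> y))) \<and>
     (\<forall>c x. \<tau> (c *\<^sub>C x) = (\<lambda>z. c *\<^sub>C fst (\<tau> x) z, c *\<^sub>C snd (\<tau> x))) \<and>
     (\<forall>x y. hardy_inner (fst (\<tau> x)) (fst (\<tau> y)) + cinner (snd (\<tau> x)) (snd (\<tau> y)) = cinner x y)"

definition bcl_tuple ::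
  "complex \<Rightarrow> 'f::chilbert_space set \<Rightarrow> 'k::chilbert_space set
    \<Rightarrow> ('f \<Rightarrow> 'f) \<Rightarrow> ('f \<Rightarrow> 'f) \<Rightarrow> ('k \<Rightarrow> 'k) \<Rightarrow> ('k \<Rightarrow> 'k) \<Rightarrow> bool" where
  "bcl_tuple q F K P U W1 W2 \<longleftrightarrow>
     closed_csubspace F \<and> closed_csubspace K \<and> projection_on F P \<and> unitary_on F U \<and>
     unitary_on K W1 \<and> unitary_on K W2 \<and> q_commuting_on K q W1 W2"

text \<open>
  \<open>bcl1_model\<close> and \<open>bcl2_model\<close>: the tuple is as required and the unitary \<open>\<tau>\<close> implements the
  equivalence of \<open>(V1, V2)\<close> with the corresponding model pair. A block diagonal operator on the
  direct sum is a \<^const>\<open>map_prod\<close>.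
\<close>

definition bcl1_model ::
  "complex \<Rightarrow> ('a::chilbert_space \<Rightarrow> 'a) \<Rightarrow> ('a \<Rightarrow> 'a) \<Rightarrow> 'f::chilbert_space set \<Rightarrow> 'k::chilbert_space set
    \<Rightarrow> ('f \<Rightarrow> 'f) \<Rightarrow> ('f \<Rightarrow> 'f) \<Rightarrow> ('k \<Rightarrow> 'k) \<Rightarrow> ('k \<Rightarrow> 'k)
    \<Rightarrow> ('a \<Rightarrow> (complex \<Rightarrow> 'f) \<times> 'k) \<Rightarrow> bool" where
  "bcl1_model q V1 V2 F K P U W1 W2 \<tau> \<longleftrightarrow>
     bcl_tuple q F K P U W1 W2 \<and> model_unitary F K \<tau> \<and>
     \<tau> \<circ> V1 = map_prod (R_rot q \<otimes>\<^sub>H (perp P \<circ> U) \<oplus>\<^sub>H (M_z \<circ> R_rot q) \<otimes>\<^sub>H (P \<circ> U)) W1 \<circ> \<tau> \<and>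
     \<tau> \<circ> V2 = map_prod (R_rot (cnj q) \<otimes>\<^sub>H (adj_on F U \<circ> P)
                 \<oplus>\<^sub>H (R_rot (cnj q) \<circ> M_z) \<otimes>\<^sub>H (adj_on F U \<circ> perp P)) W2 \<circ> \<tau>"

definition bcl2_model ::
  "complex \<Rightarrow> ('a::chilbert_space \<Rightarrow> 'a) \<Rightarrow> ('a \<Rightarrow> 'a) \<Rightarrow> 'f::chilbert_space set \<Rightarrow> 'k::chilbert_space set
    \<Rightarrow> ('f \<Rightarrow> 'f) \<Rightarrow> ('f \<Rightarrow> 'f) \<Rightarrow> ('k \<Rightarrow> 'k) \<Rightarrow> ('k \<Rightarrow> 'k)
    \<Rightarrow> ('a \<Rightarrow> (complex \<Rightarrow> 'f) \<times> 'k) \<Rightarrow> bool" where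
  "bcl2_model q V1 V2 F K P U W1 W2 \<tau> \<longleftrightarrow>
     bcl_tuple q F K P U W1 W2 \<and> model_unitary F K \<tau> \<and>
     \<tau> \<circ> V1 = map_prod (R_rot q \<otimes>\<^sub>H (adj_on F U \<circ> perp P)
                 \<oplus>\<^sub>H (M_z \<circ> R_rot q) \<otimes>\<^sub>H (adj_on F U \<circ> P)) W1 \<circ> \<tau> \<and>
     \<tau> \<circ> V2 = map_prod (R_rot (cnj q) \<otimes>\<^sub>H (P \<circ> U)
                 \<oplus>\<^sub>H (R_rot (cnj q) \<circ> M_z) \<otimes>\<^sub>H (perp P \<circ> U)) W2 \<circ> \<tau>"

section \<open>The explicit choices\<close>

definition bcl_F :: "('a::chilbert_space \<Rightarrow> 'a) \<Rightarrow> ('a \<Rightarrow> 'a) \<Rightarrow> ('a \<times> 'a) set" where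
  "bcl_F V1 V2 = defect_space (cadj V1) \<times> defect_space (cadj V2)"

definition bcl_K :: "('a::chilbert_space \<Rightarrow> 'a) \<Rightarrow> ('a \<Rightarrow> 'a) \<Rightarrow> 'a set" where
  "bcl_K V1 V2 = (\<Inter>n. range ((V1 \<circ> V2) ^^ n))"

definition bcl_P :: "'a::chilbert_space \<times> 'a \<Rightarrow> 'a \<times> 'a" where
  "bcl_P = (\<lambda>(f, g). (f, 0))"

definition is_bcl_U ::
  "('a::chilbert_space \<Rightarrow> 'a) \<Rightarrow> ('a \<Rightarrow> 'a) \<Rightarrow> ('a \<times> 'a \<Rightarrow> 'a \<times> 'a) \<Rightarrow> bool" where
  "is_bcl_U V1 V2 U \<longleftrightarrow>
     unitary_on (bcl_F V1 V2) U \<and>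
     (\<forall>h. U (defect (cadj V1) h, defect (cadj V2) (cadj V1 h))
        = (defect (cadj V1) (cadj V2 h), defect (cadj V2) h))"

text \<open>
  The first component below is the function \<open>z \<mapsto> \<Sum>n. z\<^sup>n A V\<^sup>*\<^sup>n h\<close> with \<open>V = V1 V2\<close> and \<open>A\<close> the column
  of \<open>D\<^bsub>V1\<^sup>*\<^esub>\<close> and \<open>D\<^bsub>V2\<^sup>*\<^esub> V1\<^sup>*\<close>. The convergence of the series and of the limit are part of the
  predicate.

  Let \<open>P\<close>, \<open>U\<close>, \<open>\<tau>\<close> be the explicit data of the first model. Since \<open>(I \<otimes> U) (I \<otimes> P\<^sup>\<bottom>U) (I \<otimes> U\<^sup>*) = I \<otimes> UP\<^sup>\<bottom>\<close>
  and so on, the second model holds with \<open>P\<^sub>\<dagger> = P\<close>, \<open>U\<^sub>\<dagger> = U\<^sup>*\<close>, \<open>\<tau>\<^sub>\<dagger> = ((I \<otimes> U) \<oplus> I) \<tau>\<close>, and also with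
  \<open>P\<^sub>\<dagger> = U\<^sup>*PU\<close>, \<open>U\<^sub>\<dagger> = U\<^sup>*\<close>, \<open>\<tau>\<^sub>\<dagger> = \<tau>\<close>. The choices \<open>P\<^sub>\<dagger> = P\<close>, \<open>U\<^sub>\<dagger> = U\<^sup>*\<close>, \<open>\<tau>\<^sub>\<dagger> = \<tau>\<close> are in general not
  compatible: take the coordinate multiplications on the Hardy space of the bidisk (so \<open>q = 1\<close>)
  and \<open>h = z1\<close>. Then \<open>V\<^sup>*h = 0\<close>, so the constant term of the adjoint of the first operator of
  the second model applied to \<open>\<tau> h\<close> lies in the range of \<open>P\<^sup>\<bottom>\<close>, while that of \<open>\<tau> (V1\<^sup>* h) = \<tau> 1\<close> is \<open>(1, 0)\<close>.
\<close>

definition is_bcl_tau ::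
  "('a::chilbert_space \<Rightarrow> 'a) \<Rightarrow> ('a \<Rightarrow> 'a) \<Rightarrow> ('a \<Rightarrow> (complex \<Rightarrow> 'a \<times> 'a) \<times> 'a) \<Rightarrow> bool" where
  "is_bcl_tau V1 V2 \<tau> \<longleftrightarrow> (\<forall>h.
     power_series_on_disk
       (\<lambda>n. let g = (cadj (V1 \<circ> V2) ^^ n) h in (defect (cadj V1) g, defect (cadj V2) (cadj V1 g)))
       (fst (\<tau> h)) \<and>
     (\<lambda>n. ((V1 \<circ> V2) ^^ n) (((cadj V2 \<circ> cadj V1) ^^ n) h)) \<longlonglongrightarrow> snd (\<tau> h))"

end

theory Submission
  imports Defs
begin

text \<open>
  For an isometry \<open>V\<close> the operator \<open>I - VV\<^sup>*\<close> is a projection, so it is its own square root and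
  the defect space of \<open>V\<^sup>*\<close> is the kernel of \<open>V\<^sup>*\<close>. With \<open>V = V1 V2\<close>, the column
  \<open>A = (D\<^bsub>V1\<^sup>*\<^esub>, D\<^bsub>V2\<^sup>*\<^esub> V1\<^sup>*)\<close> maps onto \<open>F\<close>, with right inverse \<open>(f, g) \<mapsto> f + V1 g\<close> into the
  kernel of \<open>V\<^sup>*\<close>, and \<open>\<langle>Ax, Ay\<rangle> = \<langle>x, y\<rangle> - \<langle>V\<^sup>*x, V\<^sup>*y\<rangle>\<close>. Replacing \<open>x, y\<close> by \<open>V\<^sup>*\<^sup>nx, V\<^sup>*\<^sup>ny\<close> and
  telescoping shows that \<open>\<tau>\<close> is isometric; it is onto because \<open>\<Sum>n. V\<^sup>n (f\<^sub>n + V1 g\<^sub>n)\<close> has Taylor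
  coefficients \<open>(f\<^sub>n, g\<^sub>n)\<close>. The column \<open>(D\<^bsub>V1\<^sup>*\<^esub> V2\<^sup>*, D\<^bsub>V2\<^sup>*\<^esub>)\<close> satisfies the same identity, as
  \<open>V1\<^sup>*V2\<^sup>* = q V\<^sup>*\<close>, which gives the unitary \<open>U\<close>. The intertwining relations are compared
  coefficientwise. The second model for \<open>(P, U)\<close> is the first one for \<open>(U\<^sup>*PU, U\<^sup>*)\<close>.
\<close>

section \<open>Hilbert spaces and bounded operators\<close>

lemma scaleC_minus1: "(-1) *\<^sub>C x = - (x::'a::chilbert_space)"
  using scaleC_of_real[of "-1" x] by simp

lemma scaleC_one [simp]: "1 *\<^sub>C x = (x::'a::chilbert_space)"
  using scaleC_of_real[of 1 x] by simp

lemma scaleC_zero_left [simp]: "0 *\<^sub>C x = (0::'a::chilbert_space)"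
  using scaleC_of_real[of 0 x] by simp

lemma scaleC_zero_right [simp]: "c *\<^sub>C 0 = (0::'a::chilbert_space)"
  using scaleC_add_right[of c 0 "0::'a"] by simp

lemma scaleC_minus_right: "c *\<^sub>C (- x) = - (c *\<^sub>C (x::'a::chilbert_space))"
  by (metis add.right_inverse add_eq_0_iff scaleC_add_right scaleC_zero_right)

lemma scaleC_diff_right: "c *\<^sub>C (x - y) = c *\<^sub>C x - c *\<^sub>C (y::'a::chilbert_space)"
  using scaleC_add_right[of c x "- y"] by (simp add: scaleC_minus_right)

lemma scaleC_cancel_unimodular:
  assumes "cmod q = 1"
  shows "q *\<^sub>C cnj q *\<^sub>C x = (x::'a::chilbert_space)" "cnj q *\<^sub>C q *\<^sub>C x = x"
  using assms by (simp_all add: scaleC_scaleC complex_norm_square[symmetric] mult.commute[of "cnj q"])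

lemma cinner_0_right [simp]: "cinner (y::'a::chilbert_space) 0 = 0"
  using cinner_diff_right[of y 0 0] by simp

lemma cinner_add_right: "cinner z (x + y) = cinner z x + cinner z (y::'a::chilbert_space)"
  by (metis cinner_commute cinner_add_left complex_cnj_add)

lemma cinner_scaleC_right: "cinner x (c *\<^sub>C y) = cnj c * cinner x (y::'a::chilbert_space)"
  by (metis cinner_commute cinner_scaleC_left complex_cnj_mult)

lemmas cinner_linear = cinner_add_left cinner_add_right cinner_diff_left cinner_diff_right
  cinner_scaleC_left cinner_scaleC_right

lemma cinner_eq_0_swap: "cinner x y = 0 \<Longrightarrow> cinner y (x::'a::chilbert_space) = 0"
  by (metis cinner_commute complex_cnj_zero)

lemma cinner_right_eqI:
  assumes "\<And>u. cinner u x = cinner u (y::'a::chilbert_space)"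
  shows "x = y"
  using assms[of "x - y"] cinner_self_eq_0[of "x - y"] by (simp add: cinner_diff_right)

lemma bounded_linear_scaleC: "bounded_linear (\<lambda>x::'a::chilbert_space. c *\<^sub>C x)"
proof (rule bounded_linear_intro)
  show "c *\<^sub>C (r *\<^sub>R x) = r *\<^sub>R (c *\<^sub>C x)" for r and x :: 'a
    by (simp add: scaleC_of_real[symmetric] scaleC_scaleC mult.commute)
  show "norm (c *\<^sub>C x) \<le> norm x * cmod c" for x :: 'a
    by (simp add: norm_scaleC)
qed (rule scaleC_add_right)

lemma tendsto_cinner_left:
  assumes "(f \<longlongrightarrow> l) F"
  shows "((\<lambda>n. cinner (f n) (y::'a::chilbert_space)) \<longlongrightarrow> cinner l y) F"
  by (rule bounded_linear.tendsto[OF bounded_linear_cinner_left assms])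

lemma of_real_norm_power2: "(complex_of_real (norm x))\<^sup>2 = cinner x (x::'a::chilbert_space)"
  by (simp add: cinner_self)

lemma pythagoras:
  assumes "cinner x (y::'a::chilbert_space) = 0"
  shows "(norm (x + y))\<^sup>2 = (norm x)\<^sup>2 + (norm y)\<^sup>2"
proof -
  have "complex_of_real ((norm (x + y))\<^sup>2) = complex_of_real ((norm x)\<^sup>2 + (norm y)\<^sup>2)"
    using assms cinner_eq_0_swap[OF assms] by (simp add: cinner_linear of_real_norm_power2)
  then show ?thesis
    using of_real_eq_iff by blast
qed

lemma norm_eq_of_cinner:
  assumes "cinner x x = cinner y (y::'a::chilbert_space)"
  shows "norm (x::'b::chilbert_space) = norm y"
proof -
  have "complex_of_real ((norm x)\<^sup>2) = complex_of_real ((norm y)\<^sup>2)"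
    using assms by (simp only: cinner_self)
  then show ?thesis
    by (simp only: of_real_eq_iff power2_eq_iff_nonneg norm_ge_zero)
qed

lemma parallelogram_law:
  fixes x y :: "'a::chilbert_space"
  shows "(norm (x + y))\<^sup>2 + (norm (x - y))\<^sup>2 = 2 * (norm x)\<^sup>2 + 2 * (norm y)\<^sup>2"
proof -
  have "complex_of_real ((norm (x + y))\<^sup>2 + (norm (x - y))\<^sup>2)
      = complex_of_real (2 * (norm x)\<^sup>2 + 2 * (norm y)\<^sup>2)"
    by (simp add: cinner_linear of_real_norm_power2)
  then show ?thesis
    using of_real_eq_iff by blast
qed

section \<open>Closed subspaces and bounded operators on them\<close>

lemma closed_csubspaceD:
  assumes "closed_csubspace S"
  shows "0 \<in> S" "x \<in> S \<Longrightarrow> y \<in> S \<Longrightarrow> x + y \<in> S" "x \<in> S \<Longrightarrow> c *\<^sub>C x \<in> S" "closed S"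
    "x \<in> S \<Longrightarrow> y \<in> S \<Longrightarrow> x - y \<in> S"
proof -
  show "x \<in> S \<Longrightarrow> y \<in> S \<Longrightarrow> x - y \<in> S"
    using assms scaleC_minus1[of y] unfolding closed_csubspace_def
    by (metis add_uminus_conv_diff)
qed (use assms[unfolded closed_csubspace_def] in blast)+

lemma closed_csubspace_UNIV [simp]: "closed_csubspace UNIV"
  by (simp add: closed_csubspace_def)

lemma closed_csubspace_Times:
  "closed_csubspace S \<Longrightarrow> closed_csubspace T \<Longrightarrow> closed_csubspace (S \<times> T)"
  by (auto simp: closed_csubspace_def scaleC_prod_def zero_prod_def closed_Times)

lemma bounded_opD:
  assumes "bounded_op S A"
  shows "x \<in> S \<Longrightarrow> A x \<in> S" "x \<in> S \<Longrightarrow> y \<in> S \<Longrightarrow> A (x + y) = A x + A y"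
    "x \<in> S \<Longrightarrow> A (c *\<^sub>C x) = c *\<^sub>C A x"
  using assms by (auto simp: bounded_op_def)

lemma bounded_op_norm_bound: "bounded_op S A \<Longrightarrow> \<exists>b. \<forall>x\<in>S. norm (A x) \<le> b * norm x"
  by (simp add: bounded_op_def)

lemma bounded_opI:
  assumes "\<And>x. x \<in> S \<Longrightarrow> A x \<in> S" "\<And>x y. x \<in> S \<Longrightarrow> y \<in> S \<Longrightarrow> A (x + y) = A x + A y"
    "\<And>c x. x \<in> S \<Longrightarrow> A (c *\<^sub>C x) = c *\<^sub>C A x" "\<And>x. x \<in> S \<Longrightarrow> norm (A x) \<le> b * norm x"
  shows "bounded_op S A"
  unfolding bounded_op_def using assms by (intro conjI exI[of _ b]) auto

lemma bounded_op_diff: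
  assumes "closed_csubspace S" "bounded_op S A" "x \<in> S" "y \<in> S"
  shows "A (x - y) = A x - A y"
  using bounded_opD(2)[OF assms(2) closed_csubspaceD(5)[OF assms(1,3,4)] assms(4)] by simp

lemma bounded_op_0: "closed_csubspace S \<Longrightarrow> bounded_op S A \<Longrightarrow> A 0 = 0"
  using bounded_op_diff[of S A 0 0] closed_csubspaceD(1)[of S] by simp

lemma bounded_op_compose:
  assumes A: "bounded_op S A" and B: "bounded_op S B"
  shows "bounded_op S (A \<circ> B)"
proof -
  obtain a where a: "\<forall>x\<in>S. norm (A x) \<le> a * norm x"
    using bounded_op_norm_bound[OF A] by blast
  obtain b where b: "\<forall>x\<in>S. norm (B x) \<le> b * norm x"
    using bounded_op_norm_bound[OF B] by blast
  have "norm (A (B x)) \<le> \<bar>a\<bar> * b * norm x" if "x \<in> S" for x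
  proof -
    have "norm (A (B x)) \<le> a * norm (B x)"
      using a that bounded_opD(1)[OF B] by blast
    also have "\<dots> \<le> \<bar>a\<bar> * (b * norm x)"
      using b that by (intro mult_mono) auto
    finally show ?thesis by (simp add: mult.assoc)
  qed
  then show ?thesis
    by (intro bounded_opI[where b = "\<bar>a\<bar> * b"])
      (simp_all add: bounded_opD[OF A] bounded_opD[OF B])
qed

lemma bounded_op_scaleC:
  assumes S: "closed_csubspace S" and A: "bounded_op S A"
  shows "bounded_op S (\<lambda>x. c *\<^sub>C A x)"
proof -
  obtain a where a: "\<forall>x\<in>S. norm (A x) \<le> a * norm x"
    using bounded_op_norm_bound[OF A] by blast
  have "norm (c *\<^sub>C A x) \<le> (cmod c * a) * norm x" if "x \<in> S" for x
    using mult_left_mono[of "norm (A x)" "a * norm x" "cmod c"] a that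
    by (simp add: norm_scaleC mult.assoc)
  then show ?thesis
    using closed_csubspaceD(3)[OF S]
    by (intro bounded_opI[where b = "cmod c * a"])
      (simp_all add: bounded_opD[OF A] scaleC_add_right scaleC_scaleC mult.commute[of c])
qed

lemma bounded_op_perp:
  assumes S: "closed_csubspace S" and A: "bounded_op S A"
  shows "bounded_op S (perp A)"
proof -
  obtain a where a: "\<forall>x\<in>S. norm (A x) \<le> a * norm x"
    using bounded_op_norm_bound[OF A] by blast
  have "norm (x - A x) \<le> (1 + a) * norm x" if "x \<in> S" for x
  proof -
    have "norm (A x) \<le> a * norm x"
      using a that by blast
    then show ?thesis
      using norm_triangle_ineq4[of x "A x"] unfolding distrib_right mult_1 by linarith
  qed
  then show ?thesis
    using closed_csubspaceD(5)[OF S] unfolding perp_def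
    by (intro bounded_opI[where b = "1 + a"])
      (simp_all add: bounded_opD[OF A] scaleC_diff_right)
qed

text \<open>\<open>A\<close> is linear and bounded only on \<open>S\<close>, so its continuity is
  derived there: partial sums stay in \<open>S\<close>, closedness brings in the limit, and the norm
  bound is applied to the differences.\<close>

lemma bounded_op_sums:
  assumes S: "closed_csubspace S" and A: "bounded_op S A" and a: "\<And>n. a n \<in> S" and s: "a sums s"
  shows "s \<in> S" "(\<lambda>n. A (a n)) sums A s"
proof -
  have sum: "(\<Sum>i<n. a i) \<in> S" and sumA: "A (\<Sum>i<n. a i) = (\<Sum>i<n. A (a i))" for n
  proof (induction n)
    case 0
    case 1 show ?case using closed_csubspaceD(1)[OF S] by simp
    case 2 show ?case using bounded_op_0[OF S A] by simp
  next
    case (Suc n)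
    case 1 show ?case using Suc(1) a closed_csubspaceD(2)[OF S] by simp
    case 2 show ?case using Suc a by (simp add: bounded_opD(2)[OF A])
  qed
  have lim: "(\<lambda>n. \<Sum>i<n. a i) \<longlonglongrightarrow> s"
    using s by (simp add: sums_def)
  show "s \<in> S"
    by (rule closed_sequentially[OF closed_csubspaceD(4)[OF S] sum lim])
  obtain b where b: "\<forall>x\<in>S. norm (A x) \<le> b * norm x"
    using bounded_op_norm_bound[OF A] by blast
  have "(\<lambda>n. b * norm ((\<Sum>i<n. a i) - s)) \<longlonglongrightarrow> 0"
    using lim by (auto intro!: tendsto_eq_intros simp: LIM_zero tendsto_norm_zero)
  moreover have "norm ((\<Sum>i<n. A (a i)) - A s) \<le> b * norm ((\<Sum>i<n. a i) - s)" for n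
    using b \<open>s \<in> S\<close> sum sumA bounded_op_diff[OF S A] closed_csubspaceD(5)[OF S] by metis
  ultimately have "(\<lambda>n. (\<Sum>i<n. A (a i)) - A s) \<longlonglongrightarrow> 0"
    by (rule Lim_null_comparison[OF always_eventually[OF allI], rotated])
  then show "(\<lambda>n. A (a n)) sums A s"
    by (simp add: sums_def LIM_zero_iff)
qed

lemma bounded_linear_bounded_op:
  assumes "bounded_op UNIV A"
  shows "bounded_linear A"
proof -
  obtain b where b: "\<forall>x. norm (A x) \<le> b * norm x"
    using bounded_op_norm_bound[OF assms] by blast
  show ?thesis
  proof (rule bounded_linear_intro)
    show "A (r *\<^sub>R x) = r *\<^sub>R A x" for r x
      using bounded_opD(3)[OF assms] by (metis UNIV_I scaleC_of_real)
    show "norm (A x) \<le> norm x * b" for x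
      using b by (simp add: mult.commute)
  qed (use bounded_opD(2)[OF assms] in simp)
qed

text \<open>The adjoint of a unitary is its inverse; \<open>L\<close> and \<open>R\<close> below
  establish this, and the other properties are transported along it.\<close>

lemma unitary_on_adj:
  assumes S: "closed_csubspace S" and U: "unitary_on S U"
  shows "unitary_on S (adj_on S U)"
    and "x \<in> S \<Longrightarrow> adj_on S U (U x) = x" and "x \<in> S \<Longrightarrow> U (adj_on S U x) = x"
    and "x \<in> S \<Longrightarrow> adj_on S (adj_on S U) x = U x"
    and "x \<in> S \<Longrightarrow> y \<in> S \<Longrightarrow> cinner (U x) y = cinner x (adj_on S U y)"
proof -
  have bU: "bounded_op S U" and im: "U ` S = S"
    and iso: "\<And>x y. x \<in> S \<Longrightarrow> y \<in> S \<Longrightarrow> cinner (U x) (U y) = cinner x y"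
    using U by (auto simp: unitary_on_def)
  have L: "adj_on S U (U x) = x" if "x \<in> S" for x
    using that iso by (intro adj_on_eqI[OF S]) auto
  then show "x \<in> S \<Longrightarrow> adj_on S U (U x) = x" .
  have R: "adj_on S U x \<in> S \<and> U (adj_on S U x) = x" if x: "x \<in> S" for x
    using x im L by (metis image_iff)
  then show "x \<in> S \<Longrightarrow> U (adj_on S U x) = x" by blast
  have adj: "cinner (U x) y = cinner x (adj_on S U y)" if "x \<in> S" "y \<in> S" for x y
    using R[OF that(2)] iso[OF that(1)] by metis
  then show "x \<in> S \<Longrightarrow> y \<in> S \<Longrightarrow> cinner (U x) y = cinner x (adj_on S U y)" .
  have iso': "cinner (adj_on S U x) (adj_on S U y) = cinner x y" if "x \<in> S" "y \<in> S" for x y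
    using R that iso by metis
  have "adj_on S U (x + y) = adj_on S U x + adj_on S U y" if "x \<in> S" "y \<in> S" for x y
    using R that L[of "adj_on S U x + adj_on S U y"] bounded_opD(2)[OF bU] closed_csubspaceD[OF S]
    by metis
  moreover have "adj_on S U (c *\<^sub>C x) = c *\<^sub>C adj_on S U x" if "x \<in> S" for c x
    using R that L[of "c *\<^sub>C adj_on S U x"] bounded_opD(3)[OF bU] closed_csubspaceD[OF S]
    by metis
  moreover have "norm (adj_on S U x) \<le> 1 * norm x" if "x \<in> S" for x
    using norm_eq_of_cinner[OF iso'[OF that that]] by simp
  ultimately have "bounded_op S (adj_on S U)"
    using R by (intro bounded_opI[where b = 1]) simp_all
  moreover have "adj_on S U ` S = S"
    using R L bounded_opD(1)[OF bU] by (force simp: image_iff)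
  ultimately show "unitary_on S (adj_on S U)"
    using iso' by (simp add: unitary_on_def)
  show "x \<in> S \<Longrightarrow> adj_on S (adj_on S U) x = U x"
  proof (rule adj_on_eqI[OF S])
    show "x \<in> S \<Longrightarrow> U x \<in> S"
      by (rule bounded_opD(1)[OF bU])
    show "x \<in> S \<Longrightarrow> u \<in> S \<Longrightarrow> cinner (adj_on S U u) x = cinner u (U x)" for u
      using adj[of x u] by (metis cinner_commute)
  qed
qed

text \<open>A sequence in \<open>S\<close> minimising the distance to \<open>y\<close> is Cauchy by
  the parallelogram law; its limit is the foot of the perpendicular. This is what makes adjoints of
  isometries exist.\<close>

lemma orthogonal_projection_exists:
  fixes y :: "'a::chilbert_space"
  assumes S: "closed_csubspace S"
  shows "\<exists>p\<in>S. \<forall>u\<in>S. cinner (y - p) u = 0"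
proof -
  define d where "d = (INF s\<in>S. (norm (y - s))\<^sup>2)"
  have bdd: "bdd_below ((\<lambda>s. (norm (y - s))\<^sup>2) ` S)"
    by (rule bdd_belowI[of _ 0]) auto
  have d: "d \<le> (norm (y - s))\<^sup>2" if "s \<in> S" for s
    unfolding d_def by (rule cINF_lower[OF bdd that])
  have "\<exists>s\<in>S. (norm (y - s))\<^sup>2 < d + inverse (real (Suc n))" for n
    unfolding d_def using bdd closed_csubspaceD(1)[OF S]
    by (subst cInf_less_iff[symmetric, where X = "(\<lambda>s. (norm (y - s))\<^sup>2) ` S", simplified]) auto
  then obtain s where s: "\<And>n. s n \<in> S" "\<And>n. (norm (y - s n))\<^sup>2 < d + inverse (real (Suc n))"
    by metis
  have close: "(norm (s m - s n))\<^sup>2 \<le> 2 * inverse (real (Suc m)) + 2 * inverse (real (Suc n))" for m n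
  proof -
    \<comment> \<open>The midpoint again lies in \<open>S\<close>, so its squared distance to
      \<open>y\<close> is at least \<open>d\<close>; this bounds the gap between \<open>s m\<close>
      and \<open>s n\<close>.\<close>
    define h where "h = complex_of_real (1/2) *\<^sub>C (s m + s n)"
    have h: "h \<in> S"
      unfolding h_def by (intro closed_csubspaceD(2,3)[OF S] s(1))
    have "h + h = s m + s n"
      unfolding h_def by (simp add: scaleC_add_left[symmetric])
    then have sum: "(y - s n) + (y - s m) = 2 *\<^sub>R (y - h)"
      by (simp add: scaleR_2 algebra_simps)
    have "(norm (2 *\<^sub>R (y - h)))\<^sup>2 = 4 * (norm (y - h))\<^sup>2"
      unfolding norm_scaleR by (simp add: power_mult_distrib)
    moreover have "(y - s n) - (y - s m) = s m - s n"
      by simp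
    ultimately have "4 * (norm (y - h))\<^sup>2 + (norm (s m - s n))\<^sup>2
        = 2 * (norm (y - s n))\<^sup>2 + 2 * (norm (y - s m))\<^sup>2"
      using parallelogram_law[of "y - s n" "y - s m"] by (simp only: sum)
    then show ?thesis
      using d[OF h] s(2)[of m] s(2)[of n] by linarith
  qed
  have "Cauchy s"
  proof (rule metric_CauchyI)
    fix e :: real assume e: "0 < e"
    obtain N where N: "inverse (real (Suc N)) < e\<^sup>2 / 4"
      using reals_Archimedean[of "e\<^sup>2 / 4"] e by auto
    have "dist (s m) (s n) < e" if "m \<ge> N" "n \<ge> N" for m n
    proof -
      have "inverse (real (Suc m)) \<le> inverse (real (Suc N))"
        "inverse (real (Suc n)) \<le> inverse (real (Suc N))"
        using that by (simp_all add: le_imp_inverse_le)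
      then have "(norm (s m - s n))\<^sup>2 < e\<^sup>2"
        using close[of m n] N by linarith
      then show ?thesis
        using e by (simp add: dist_norm power2_less_imp_less)
    qed
    then show "\<exists>M. \<forall>m\<ge>M. \<forall>n\<ge>M. dist (s m) (s n) < e" by blast
  qed
  then obtain p where p: "s \<longlonglongrightarrow> p"
    using Cauchy_convergent_iff convergent_def by blast
  have pS: "p \<in> S"
    using closed_sequentially[OF closed_csubspaceD(4)[OF S]] s(1) p by blast
  have "(\<lambda>n. (norm (y - s n))\<^sup>2) \<longlonglongrightarrow> (norm (y - p))\<^sup>2"
    by (intro tendsto_intros p)
  moreover have "(\<lambda>n. d + inverse (real (Suc n))) \<longlonglongrightarrow> d + 0"
    by (intro tendsto_intros LIMSEQ_inverse_real_of_nat)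
  ultimately have pd: "(norm (y - p))\<^sup>2 \<le> d"
    using LIMSEQ_le s(2) by (metis (no_types, lifting) add.right_neutral less_imp_le)
  have "cinner (y - p) u = 0" if u: "u \<in> S" for u
  proof (cases "u = 0")
    case False
    \<comment> \<open>The component of the residual along \<open>u\<close>: moving \<open>p\<close>
      by \<open>c *\<^sub>C u\<close> would bring it strictly closer to \<open>y\<close> than the
      minimum unless \<open>c = 0\<close>.\<close>
    define c where "c = cinner (y - p) u / complex_of_real ((norm u)\<^sup>2)"
    have c: "c * complex_of_real ((norm u)\<^sup>2) = cinner (y - p) u"
      using False by (simp add: c_def)
    define w where "w = y - p - c *\<^sub>C u"
    have "cinner w (c *\<^sub>C u) = 0"
      using c by (simp add: w_def cinner_linear cinner_self)
    then have "(norm (y - p))\<^sup>2 = (norm w)\<^sup>2 + (norm (c *\<^sub>C u))\<^sup>2"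
      using pythagoras[of w "c *\<^sub>C u"] by (simp add: w_def)
    moreover have "d \<le> (norm w)\<^sup>2"
      using d[of "p + c *\<^sub>C u"] pS u closed_csubspaceD[OF S] by (simp add: w_def algebra_simps)
    ultimately have "(norm (c *\<^sub>C u))\<^sup>2 \<le> 0"
      using pd by linarith
    then have "c = 0"
      using False by (simp add: norm_scaleC)
    then show ?thesis
      using c by simp
  qed simp
  then show ?thesis
    using pS by blast
qed

lemma sum_norm_square_orthogonal:
  fixes f :: "nat \<Rightarrow> 'a::chilbert_space"
  assumes orth: "\<And>m n. m < n \<Longrightarrow> cinner (f m) (f n) = 0" and fin: "finite I"
  shows "(norm (\<Sum>i\<in>I. f i))\<^sup>2 = (\<Sum>i\<in>I. (norm (f i))\<^sup>2)"
  using fin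
proof (induction I)
  case (insert n I)
  have "cinner (f n) (\<Sum>i\<in>J. f i) = 0" if "finite J" "n \<notin> J" for J
    using that
  proof (induction J)
    case (insert m J)
    then have "cinner (f n) (f m) = 0"
      using orth[of m n] orth[of n m] by (metis cinner_eq_0_swap insertCI linorder_neqE_nat)
    then show ?case
      using insert by (simp add: cinner_add_right)
  qed simp
  then show ?case
    using insert by (simp add: pythagoras)
qed simp

text \<open>Pythagoras carries the Cauchy criterion for the squared norms over to the partial sums.
  This gives convergence even where absolute convergence fails.\<close>

lemma summable_orthogonal:
  fixes f :: "nat \<Rightarrow> 'a::chilbert_space"
  assumes orth: "\<And>m n. m < n \<Longrightarrow> cinner (f m) (f n) = 0"
    and sq: "summable (\<lambda>n. (norm (f n))\<^sup>2)"
  shows "summable f"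
  unfolding summable_Cauchy
proof (intro allI impI)
  fix e :: real assume e: "0 < e"
  then obtain N where N: "\<And>m n. m \<ge> N \<Longrightarrow> norm (\<Sum>i=m..<n. (norm (f i))\<^sup>2) < e\<^sup>2"
    using sq unfolding summable_Cauchy by (meson zero_less_power)
  have "norm (sum f {m..<n}) < e" if "m \<ge> N" for m n
  proof (rule power2_less_imp_less)
    have "(norm (sum f {m..<n}))\<^sup>2 = (\<Sum>i=m..<n. (norm (f i))\<^sup>2)"
      using orth by (rule sum_norm_square_orthogonal) auto
    then show "(norm (sum f {m..<n}))\<^sup>2 < e\<^sup>2"
      using N[OF that, of n] unfolding real_norm_def by linarith
  qed (use e in simp)
  then show "\<exists>N. \<forall>m\<ge>N. \<forall>n. norm (sum f {m..<n}) < e" by blast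
qed

section \<open>Isometries and their defect operators\<close>

text \<open>Polarisation: the diagonal value at \<open>x + y\<close> gives
  \<open>s x y + s y x = 0\<close>, and replacing \<open>y\<close> by
  \<open>\<i> *\<^sub>C y\<close> turns the sum into a difference.\<close>

lemma sesquilinear_eq_0:
  fixes s :: "'a::chilbert_space \<Rightarrow> 'a \<Rightarrow> complex"
  assumes diag: "\<And>x. s x x = 0"
    and add: "\<And>x y z. s (x + y) z = s x z + s y z" "\<And>x y z. s z (x + y) = s z x + s z y"
    and scale: "\<And>c x y. s (c *\<^sub>C x) y = c * s x y" "\<And>c x y. s x (c *\<^sub>C y) = cnj c * s x y"
  shows "s x y = 0"
proof -
  have swap: "s x y + s y x = 0" for x y
    using diag[of "x + y"] unfolding add by (simp add: diag add.commute)
  have "\<i> * (s y x - s x y) = 0"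
    using swap[of x "\<i> *\<^sub>C y"] by (simp add: scale right_diff_distrib)
  then have "s y x = s x y"
    by simp
  then show ?thesis
    using swap[of x y] by simp
qed

lemma positive_op_cinner:
  assumes "positive_op B"
  shows "cinner (B x) y = cinner x (B y)"
proof -
  define s where "s x y = cinner (B x) y - cinner x (B y)" for x y
  have B: "bounded_op UNIV B"
    using assms by (simp add: positive_op_def)
  have "s x y = 0"
  proof (rule sesquilinear_eq_0[of s])
    show "s x x = 0" for x
    proof -
      have "cnj (cinner (B x) x) = cinner (B x) x"
        using assms by (simp add: positive_op_def Reals_cnj_iff)
      then show ?thesis
        using cinner_commute[of x "B x"] by (simp add: s_def)
    qed
  qed (simp_all add: s_def cinner_linear bounded_opD(2,3)[OF B] right_diff_distrib)
  then show ?thesis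
    by (simp add: s_def)
qed

text \<open>Uniqueness needs no spectral theory: a positive root \<open>B\<close> vanishes on the
  kernel of \<open>E\<close> and is the identity on its range.\<close>

lemma op_sqrt_idempotent:
  assumes E: "positive_op E" and idem: "E \<circ> E = E"
  shows "op_sqrt E = E"
  unfolding op_sqrt_def
proof (rule the_equality)
  show "positive_op E \<and> E \<circ> E = E"
    using assms by simp
next
  fix B assume B: "positive_op B \<and> B \<circ> B = E"
  then have bB: "bounded_op UNIV B" and bE: "bounded_op UNIV E"
    using E by (auto simp: positive_op_def)
  have BB: "B (B x) = E x" and EE: "E (E x) = E x" for x
    using B idem by (metis comp_apply)+
  note diff = bounded_op_diff[OF closed_csubspace_UNIV]
  show "B = E"
  proof
    fix x
    \<comment> \<open>\<open>B\<close> is self-adjoint with square \<open>E\<close>, so this squared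
      norm is computed by \<open>E\<close>, which kills \<open>x - E x\<close>.\<close>
    have "cinner (B (x - E x)) (B (x - E x)) = cinner (E (x - E x)) (x - E x)"
      using B positive_op_cinner[of B] BB by metis
    also have "\<dots> = 0"
      using diff[OF bE] EE by simp
    finally have "B x = B (E x)"
      using diff[OF bB] by (simp add: cinner_self_eq_0)
    \<comment> \<open>If nonzero, this would be an eigenvector of \<open>B\<close> for the
      eigenvalue -1, which positivity excludes.\<close>
    moreover define w where "w = B (E x) - E x"
    have "B w = - w"
      using diff[OF bB] BB EE by (simp add: w_def)
    then have "cinner (B w) w = - complex_of_real ((norm w)\<^sup>2)"
      using cinner_diff_left[of 0 w w] by (simp add: cinner_self)
    then have "0 \<le> - (norm w)\<^sup>2"
      using B unfolding positive_op_def by (metis Re_complex_of_real of_real_minus)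
    then have "w = 0"
      by simp
    ultimately show "B x = E x"
      by (simp add: w_def)
  qed
qed

lemma bounded_op_norm_le:
  assumes "\<And>x y. A (x + y) = A x + A y" "\<And>c x. A (c *\<^sub>C x) = c *\<^sub>C A x" "\<And>x. norm (A x) \<le> norm x"
  shows "bounded_op UNIV A"
  by (rule bounded_opI[where b = 1]) (simp_all add: assms)

section \<open>Adjoint and defect operator of a single isometry\<close>

locale hilbert_isometry =
  fixes V :: "'a::chilbert_space \<Rightarrow> 'a"
  assumes isometry: "isometry_on UNIV V"
begin

lemma bounded: "bounded_op UNIV V"
  using isometry by (simp add: isometry_on_def)

lemma add: "V (x + y) = V x + V y" and scaleC: "V (c *\<^sub>C x) = c *\<^sub>C V x"
  and diff: "V (x - y) = V x - V y" and zero: "V 0 = 0"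
  using bounded bounded_opD[of UNIV V] bounded_op_diff[of UNIV V] bounded_op_0[of UNIV V] by simp_all

lemma norm: "norm (V x) = norm x"
  using isometry by (simp add: isometry_on_def)

lemma cinner: "cinner (V x) (V y) = cinner x y"
proof -
  define s where "s x y = cinner (V x) (V y) - cinner x y" for x y
  have "s x y = 0"
  proof (rule sesquilinear_eq_0[of s])
    show "s x x = 0" for x
      by (simp add: s_def cinner_self norm)
  qed (simp_all add: s_def cinner_linear add scaleC right_diff_distrib)
  then show ?thesis
    by (simp add: s_def)
qed

text \<open>Distances are preserved, so the preimages of a convergent sequence form a Cauchy
  sequence.\<close>

lemma closed_csubspace_range: "closed_csubspace (range V)"
proof -
  have "closed (range V)"
    unfolding closed_sequential_limits
  proof (intro allI impI)
    fix y l assume A: "(\<forall>n. y n \<in> range V) \<and> y \<longlonglongrightarrow> l"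
    then obtain x where y: "y = (\<lambda>n. V (x n))"
      by (metis image_iff)
    have "dist (x m) (x n) = dist (y m) (y n)" for m n
      by (simp add: y dist_norm norm diff[symmetric])
    then have "Cauchy x"
      using A LIMSEQ_imp_Cauchy[of y l] by (simp add: Cauchy_def)
    then obtain k where "x \<longlonglongrightarrow> k"
      using Cauchy_convergent_iff convergent_def by blast
    then have "y \<longlonglongrightarrow> V k"
      unfolding y by (rule bounded_linear.tendsto[OF bounded_linear_bounded_op[OF bounded]])
    then show "l \<in> range V"
      using A LIMSEQ_unique by blast
  qed
  moreover have "0 \<in> range V"
    using zero by (metis rangeI)
  ultimately show ?thesis
    unfolding closed_csubspace_def by (auto simp: add[symmetric] scaleC[symmetric])
qed

text \<open>\<open>cadj\<close> is a definite description, so a witness must be found first: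
  projecting \<open>y\<close> onto the closed range of \<open>V\<close> gives some
  \<open>V x\<close>, and this \<open>x\<close> is the value of the adjoint.\<close>

lemma cinner_adj_right: "cinner (V u) y = cinner u (cadj V y)"
proof -
  obtain x where "\<forall>u\<in>range V. cinner (y - V x) u = 0"
    using orthogonal_projection_exists[OF closed_csubspace_range, of y] by blast
  then have "cinner (V u) (y - V x) = 0" for u
    using cinner_eq_0_swap by blast
  then have x: "cinner (V u) y = cinner u x" for u
    by (simp add: cinner_diff_right cinner)
  then have "cadj V y = x"
    by (intro adj_on_eqI) auto
  then show ?thesis
    by (simp add: x)
qed

lemma cinner_adj_left: "cinner (cadj V y) u = cinner y (V u)"
  by (metis cinner_adj_right cinner_commute)

lemma adj_eqI: "(\<And>u. cinner (V u) y = cinner u x) \<Longrightarrow> cadj V y = x"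
  by (rule adj_on_eqI) auto

lemma adj_left_inverse: "cadj V (V x) = x"
  by (rule adj_eqI) (simp add: cinner)

lemma adj_add: "cadj V (x + y) = cadj V x + cadj V y"
  and adj_scaleC: "cadj V (c *\<^sub>C x) = c *\<^sub>C cadj V x"
  by (rule adj_eqI, simp add: cinner_linear cinner_adj_right)+

lemma norm_adj: "(norm (cadj V x))\<^sup>2 + (norm (x - V (cadj V x)))\<^sup>2 = (norm x)\<^sup>2"
  using pythagoras[of "V (cadj V x)" "x - V (cadj V x)"]
  by (simp add: norm cinner_diff_right cinner_adj_right adj_left_inverse)

lemma norm_adj_le: "norm (cadj V x) \<le> norm x"
proof (rule power2_le_imp_le)
  show "(norm (cadj V x))\<^sup>2 \<le> (norm x)\<^sup>2"
    using norm_adj[of x] zero_le_power2[of "norm (x - V (cadj V x))"] by linarith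
qed simp

lemma bounded_adj: "bounded_op UNIV (cadj V)"
  using adj_add adj_scaleC norm_adj_le by (rule bounded_op_norm_le)

lemma adj_diff: "cadj V (x - y) = cadj V x - cadj V y" and adj_zero: "cadj V 0 = 0"
  using bounded_adj bounded_op_diff[of UNIV "cadj V"] bounded_op_0[of UNIV "cadj V"] by simp_all

lemma defect_adj: "defect (cadj V) = (\<lambda>x. x - V (cadj V x))"
proof -
  define E where "E = (\<lambda>x. x - V (cadj V x))"
  \<comment> \<open>The defect operator of the adjoint involves the adjoint of the adjoint, which
    has to be identified with \<open>V\<close> before the formula reduces to
    \<open>E\<close>.\<close>
  have "cadj (cadj V) y = V y" for y
    by (rule adj_on_eqI) (simp_all add: cinner_adj_left)
  then have "defect (cadj V) = op_sqrt E"
    by (simp add: defect_def E_def)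
  also have "\<dots> = E"
  proof (rule op_sqrt_idempotent)
    show "E \<circ> E = E"
      by (auto simp: E_def adj_diff adj_left_inverse zero)
    have "bounded_op UNIV E"
    proof (rule bounded_op_norm_le)
      show "norm (E x) \<le> norm x" for x
      proof (rule power2_le_imp_le)
        show "(norm (E x))\<^sup>2 \<le> (norm x)\<^sup>2"
          unfolding E_def using norm_adj[of x] zero_le_power2[of "norm (cadj V x)"] by linarith
      qed simp
    qed (simp_all add: E_def add adj_add scaleC adj_scaleC scaleC_diff_right)
    moreover have "cinner (E x) x = complex_of_real ((norm (E x))\<^sup>2)" for x
    proof -
      have "cinner (E x) (V (cadj V x)) = 0"
        by (simp add: E_def cinner_diff_left cinner cinner_adj_left)
      then have "cinner (E x) x = cinner (E x) (E x)"
        by (simp add: E_def cinner_diff_right)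
      then show ?thesis
        by (simp only: cinner_self)
    qed
    ultimately show "positive_op E"
      by (simp add: positive_op_def)
  qed
  finally show ?thesis
    by (simp add: E_def)
qed

text \<open>The defect operator is a projection fixing exactly the kernel of the adjoint; its range
  is therefore already closed and the closure adds nothing.\<close>

lemma defect_space_adj: "defect_space (cadj V) = {x. cadj V x = 0}"
proof -
  have "range (defect (cadj V)) = {x. cadj V x = 0}"
  proof
    show "range (defect (cadj V)) \<subseteq> {x. cadj V x = 0}"
      by (auto simp: defect_adj adj_diff adj_left_inverse)
    show "{x. cadj V x = 0} \<subseteq> range (defect (cadj V))"
    proof
      fix x assume "x \<in> {x. cadj V x = 0}"
      then have "x = defect (cadj V) x"
        by (simp add: defect_adj zero)
      then show "x \<in> range (defect (cadj V))"
        by (rule range_eqI)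
    qed
  qed
  moreover have "closed {x. cadj V x = 0}"
    by (intro closed_Collect_eq linear_continuous_on bounded_linear_bounded_op bounded_adj
        continuous_on_const)
  ultimately show ?thesis
    by (simp add: defect_space_def)
qed

lemma closed_csubspace_defect_space: "closed_csubspace (defect_space (cadj V))"
  using closed_closure[of "range (defect (cadj V))"] unfolding closed_csubspace_def
  by (auto simp: defect_space_adj adj_add adj_scaleC adj_zero simp flip: defect_space_def)

end

lemma hilbert_isometry_compose:
  assumes "hilbert_isometry V" "hilbert_isometry W"
  shows "hilbert_isometry (V \<circ> W)" "cadj (V \<circ> W) = cadj W \<circ> cadj V"
proof -
  interpret V: hilbert_isometry V by fact
  interpret W: hilbert_isometry W by fact
  show "hilbert_isometry (V \<circ> W)"
    using bounded_op_compose[OF V.bounded W.bounded]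
    by unfold_locales (simp add: isometry_on_def V.norm W.norm)
  then interpret VW: hilbert_isometry "V \<circ> W" .
  show "cadj (V \<circ> W) = cadj W \<circ> cadj V"
    by (rule ext, rule VW.adj_eqI) (simp add: V.cinner_adj_right W.cinner_adj_right)
qed

section \<open>Operators on the Hardy space\<close>

text \<open>Square summable coefficients are eventually bounded by 1, so a geometric series
  dominates. The value 0 off the disk is the normalisation required by \<open>hardy\<close>.\<close>

lemma power_series_on_disk_exists:
  fixes a :: "nat \<Rightarrow> 'f::chilbert_space"
  assumes "summable (\<lambda>n. (norm (a n))\<^sup>2)"
  shows "power_series_on_disk a (\<lambda>z. if z \<in> ball 0 1 then \<Sum>n. z ^ n *\<^sub>C a n else 0)"
proof -
  have "summable (\<lambda>n. z ^ n *\<^sub>C a n)" if z: "z \<in> ball 0 1" for z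
  proof -
    have "(\<lambda>n. (norm (a n))\<^sup>2) \<longlonglongrightarrow> 0"
      by (rule summable_LIMSEQ_zero[OF assms])
    then have "\<forall>\<^sub>F n in sequentially. (norm (a n))\<^sup>2 < 1"
      by (rule order_tendstoD) simp
    then have "\<forall>\<^sub>F n in sequentially. norm (z ^ n *\<^sub>C a n) \<le> cmod z ^ n"
    proof eventually_elim
      case (elim n)
      then have "norm (a n) \<le> 1"
        using power2_le_imp_le[of "norm (a n)" 1] by simp
      then show ?case
        by (simp add: norm_scaleC norm_power mult_left_le)
    qed
    moreover have "summable (\<lambda>n. cmod z ^ n)"
      using z by (simp add: summable_geometric_iff)
    ultimately show ?thesis
      by (rule summable_comparison_test_ev)
  qed
  then show ?thesis
    by (simp add: power_series_on_disk_def summable_sums)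
qed

lemma hardyD:
  assumes F: "closed_csubspace F" and f: "f \<in> hardy F"
  shows "f z \<in> F" and "z \<notin> ball 0 1 \<Longrightarrow> f z = 0"
    and "power_series_on_disk (taylor_coeff f) f" and "taylor_coeff f n \<in> F"
    and "summable (\<lambda>n. (norm (taylor_coeff f n))\<^sup>2)"
proof -
  obtain a where a: "range a \<subseteq> F" "summable (\<lambda>n. (norm (a n))\<^sup>2)" "power_series_on_disk a f"
    using f unfolding hardy_def by blast
  have [simp]: "taylor_coeff f = a"
    by (rule taylor_coeff_eqI[OF a(3)])
  show 0: "z \<notin> ball 0 1 \<Longrightarrow> f z = 0"
    using f by (simp add: hardy_def)
  show "power_series_on_disk (taylor_coeff f) f" "taylor_coeff f n \<in> F"
    "summable (\<lambda>n. (norm (taylor_coeff f n))\<^sup>2)"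
    using a by auto
  show "f z \<in> F"
  proof (cases "z \<in> ball 0 1")
    case True
    have "(\<lambda>n. \<Sum>i<n. z ^ i *\<^sub>C a i) \<longlonglongrightarrow> f z"
      using True a(3) by (simp add: power_series_on_disk_def sums_def)
    moreover have "(\<Sum>i<n. z ^ i *\<^sub>C a i) \<in> F" for n
      by (induction n) (use a(1) in \<open>auto intro!: closed_csubspaceD(1-3)[OF F]\<close>)
    ultimately show ?thesis
      by (rule closed_sequentially[OF closed_csubspaceD(4)[OF F], rotated])
  next
    case False
    then show ?thesis
      using 0 closed_csubspaceD(1)[OF F] by simp
  qed
qed

lemma hardyI:
  assumes "\<And>z. z \<notin> ball 0 1 \<Longrightarrow> f z = 0" "\<And>n. a n \<in> F" "summable (\<lambda>n. (norm (a n))\<^sup>2)"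
    "power_series_on_disk a f"
  shows "f \<in> hardy F"
  using assms unfolding hardy_def by blast

lemma power_series_on_disk_eqI:
  assumes f: "power_series_on_disk a f" "\<And>z. z \<notin> ball 0 1 \<Longrightarrow> f z = 0"
    and g: "power_series_on_disk a g" "\<And>z. z \<notin> ball 0 1 \<Longrightarrow> g z = 0"
  shows "f = g"
proof
  fix z
  show "f z = g z"
    using f g sums_unique2 unfolding power_series_on_disk_def by (cases "z \<in> ball 0 1") (blast, simp)
qed

lemma hardy_inner_self:
  "hardy_inner f f = complex_of_real (\<Sum>n. (norm (taylor_coeff f n))\<^sup>2)"
  if "summable (\<lambda>n. (norm (taylor_coeff f n))\<^sup>2)"
  unfolding hardy_inner_def cinner_self by (rule suminf_of_real[OF that, symmetric])

lemma power_series_on_disk_pointwise: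
  assumes F: "closed_csubspace F" and A: "bounded_op F A" and a: "\<And>n. a n \<in> F"
    and f: "power_series_on_disk a f"
  shows "power_series_on_disk (\<lambda>n. A (a n)) (\<lambda>z. A (f z))"
  unfolding power_series_on_disk_def
proof
  fix z :: complex assume "z \<in> ball 0 1"
  then have "(\<lambda>n. A (z ^ n *\<^sub>C a n)) sums A (f z)"
    using a f closed_csubspaceD(3)[OF F]
    by (intro bounded_op_sums(2)[OF F A]) (auto simp: power_series_on_disk_def)
  then show "(\<lambda>n. z ^ n *\<^sub>C A (a n)) sums A (f z)"
    using a bounded_opD(3)[OF A] by simp
qed

section \<open>Rotated weighted shifts, the common form of the Hardy space blocks of both
  models\<close>

definition shift_op ::
  "complex \<Rightarrow> ('f \<Rightarrow> 'f) \<Rightarrow> ('f \<Rightarrow> 'f) \<Rightarrow> (complex \<Rightarrow> 'f) \<Rightarrow> complex \<Rightarrow> 'f::chilbert_space" where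
  "shift_op q A B f z = A (f (q * z)) + z *\<^sub>C B (f (q * z))"

text \<open>Moving \<open>M_z\<close> to the left past \<open>R_rot q\<close> costs a factor
  \<open>q\<close>, which the second equation puts on the coefficient operator.\<close>

lemma shift_op_eq:
  "R_rot q \<otimes>\<^sub>H A \<oplus>\<^sub>H (M_z \<circ> R_rot q) \<otimes>\<^sub>H B = shift_op q A B"
  "R_rot q \<otimes>\<^sub>H A \<oplus>\<^sub>H (R_rot q \<circ> M_z) \<otimes>\<^sub>H B = shift_op q A (\<lambda>v. q *\<^sub>C B v)"
  by (auto simp: fun_eq_iff op_add_def tensor_op_def M_z_def R_rot_def shift_op_def scaleC_scaleC
      mult.commute)

lemma shift_op_cong:
  assumes "\<And>z. f z \<in> F" "\<And>v. v \<in> F \<Longrightarrow> A v = A' v" "\<And>v. v \<in> F \<Longrightarrow> B v = B' v"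
  shows "shift_op q A B f = shift_op q A' B' f"
  using assms by (auto simp: shift_op_def fun_eq_iff)

text \<open>Taylor coefficients of \<open>shift_op q A B f\<close> when \<open>a\<close> are those
  of \<open>f\<close>. The \<open>B\<close> term carries \<open>q ^ m\<close> rather than
  \<open>q ^ Suc m\<close>, since the factor \<open>z\<close> in front of it is not rotated.\<close>

definition shift_coeff ::
  "complex \<Rightarrow> ('f \<Rightarrow> 'f) \<Rightarrow> ('f \<Rightarrow> 'f) \<Rightarrow> (nat \<Rightarrow> 'f) \<Rightarrow> nat \<Rightarrow> 'f::chilbert_space" where
  "shift_coeff q A B a n =
     q ^ n *\<^sub>C A (a n) + (case n of 0 \<Rightarrow> 0 | Suc m \<Rightarrow> q ^ m *\<^sub>C B (a m))"

lemma shift_op_power_series: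
  assumes q: "cmod q = 1" and F: "closed_csubspace F" and A: "bounded_op F A" and B: "bounded_op F B"
    and a: "\<And>n. a n \<in> F" and f: "power_series_on_disk a f"
  shows "power_series_on_disk (shift_coeff q A B a) (shift_op q A B f)"
  unfolding power_series_on_disk_def
proof
  fix z :: complex assume z: "z \<in> ball 0 1"
  then have qz: "q * z \<in> ball 0 1"
    using q by (simp add: norm_mult)
  have s: "(\<lambda>n. (q * z) ^ n *\<^sub>C C (a n)) sums C (f (q * z))" if "bounded_op F C" for C
    using power_series_on_disk_pointwise[OF F that a f] qz by (auto simp: power_series_on_disk_def)
  \<comment> \<open>The second series is delayed by one place with initial term 0, so that both
    series can be added term by term.\<close>
  define b where "b n = (case n of 0 \<Rightarrow> 0 | Suc m \<Rightarrow> z *\<^sub>C (q * z) ^ m *\<^sub>C B (a m))" for n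
  have "(\<lambda>n. z *\<^sub>C (q * z) ^ n *\<^sub>C B (a n)) sums (z *\<^sub>C B (f (q * z)))"
    by (rule bounded_linear.sums[OF bounded_linear_scaleC s[OF B]])
  then have "(\<lambda>n. b (Suc n)) sums (z *\<^sub>C B (f (q * z)))"
    by (simp add: b_def)
  then have "b sums (z *\<^sub>C B (f (q * z)))"
    using sums_Suc[of b] by (simp add: b_def)
  from sums_add[OF s[OF A] this]
  have "(\<lambda>n. (q * z) ^ n *\<^sub>C A (a n) + b n) sums shift_op q A B f z"
    by (simp add: shift_op_def)
  moreover have "(q * z) ^ n *\<^sub>C A (a n) + b n = z ^ n *\<^sub>C shift_coeff q A B a n" for n
    by (simp add: shift_coeff_def b_def scaleC_add_right scaleC_scaleC power_mult_distrib mult_ac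
        split: nat.split)
  ultimately show "(\<lambda>n. z ^ n *\<^sub>C shift_coeff q A B a n) sums shift_op q A B f z"
    by simp
qed

text \<open>Each output coefficient is an orthogonal sum of an \<open>A\<close> part and the
  \<open>B\<close> part of the preceding coefficient, up to unimodular factors; delaying the
  \<open>B\<close> parts by one place leaves the total of the squared norms unchanged.\<close>

lemma hardy_inner_shift_op:
  assumes q: "cmod q = 1" and F: "closed_csubspace F" and A: "bounded_op F A" and B: "bounded_op F B"
    and orth: "\<And>v w. v \<in> F \<Longrightarrow> w \<in> F \<Longrightarrow> cinner (A v) (B w) = 0"
    and norm: "\<And>v. v \<in> F \<Longrightarrow> (norm (A v))\<^sup>2 + (norm (B v))\<^sup>2 = (norm v)\<^sup>2"
    and f: "f \<in> hardy F"
  shows "hardy_inner (shift_op q A B f) (shift_op q A B f) = hardy_inner f f"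
proof -
  define a where "a = taylor_coeff f"
  have a: "a n \<in> F" "summable (\<lambda>n. (norm (a n))\<^sup>2)" "power_series_on_disk a f" for n
    unfolding a_def using hardyD[OF F f] by auto
  have tc: "taylor_coeff (shift_op q A B f) = shift_coeff q A B a"
    by (rule taylor_coeff_eqI[OF shift_op_power_series[OF q F A B a(1,3)]])
  define c where "c n = (case n of 0 \<Rightarrow> 0 | Suc m \<Rightarrow> (norm (B (a m)))\<^sup>2)" for n
  have sq: "(norm (shift_coeff q A B a n))\<^sup>2 = (norm (A (a n)))\<^sup>2 + c n" for n
  proof (cases n)
    case 0
    then show ?thesis by (simp add: shift_coeff_def c_def)
  next
    case (Suc m)
    have "cinner (q ^ n *\<^sub>C A (a n)) (q ^ m *\<^sub>C B (a m)) = 0"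
      using orth a(1) by (simp add: cinner_linear)
    then show ?thesis
      using q by (simp add: Suc shift_coeff_def c_def pythagoras norm_scaleC norm_power norm_mult)
  qed
  \<comment> \<open>In this form the sum over the \<open>A\<close> parts follows from those over
    \<open>a\<close> and over the \<open>B\<close> parts.\<close>
  have nn: "(norm (A (a n)))\<^sup>2 = (norm (a n))\<^sup>2 - (norm (B (a n)))\<^sup>2" for n
    using norm[OF a(1)[of n]] by simp
  have sB: "summable (\<lambda>n. (norm (B (a n)))\<^sup>2)"
  proof (rule summable_comparison_test[OF _ a(2)], intro exI allI impI)
    fix n
    have "(norm (B (a n)))\<^sup>2 \<le> (norm (a n))\<^sup>2"
      using norm[OF a(1)[of n]] zero_le_power2[of "norm (A (a n))"] by linarith
    then show "norm ((norm (B (a n)))\<^sup>2) \<le> (norm (a n))\<^sup>2"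
      unfolding real_norm_def by simp
  qed
  define t where "t = (\<Sum>n. (norm (a n))\<^sup>2)"
  define u where "u = (\<Sum>n. (norm (B (a n)))\<^sup>2)"
  have "(\<lambda>n. (norm (A (a n)))\<^sup>2) sums (t - u)"
    unfolding nn t_def u_def by (intro sums_diff summable_sums a(2) sB)
  moreover have "c sums u"
    using sums_Suc[of c u] summable_sums[OF sB] by (simp add: c_def u_def)
  ultimately have s: "(\<lambda>n. (norm (shift_coeff q A B a n))\<^sup>2) sums t"
    unfolding sq using sums_add by fastforce
  then have "(\<Sum>n. (norm (shift_coeff q A B a n))\<^sup>2) = t"
    by (rule sums_unique[symmetric])
  then show ?thesis
    using hardy_inner_self[of f] hardy_inner_self[of "shift_op q A B f"] s a(2) sums_summable[OF s]
    by (simp add: tc t_def flip: a_def)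
qed

section \<open>From a model to a \<open>q\<close>-commuting pair of isometries\<close>

lemma model_unitaryD:
  assumes "model_unitary F K \<tau>"
  shows "fst (\<tau> x) \<in> hardy F" "snd (\<tau> x) \<in> K"
    "cinner x y = hardy_inner (fst (\<tau> x)) (fst (\<tau> y)) + cinner (snd (\<tau> x)) (snd (\<tau> y))"
    "\<tau> (c *\<^sub>C x) = (\<lambda>z. c *\<^sub>C fst (\<tau> x) z, c *\<^sub>C snd (\<tau> x))"
proof -
  have "\<tau> x \<in> hardy F \<times> K"
    using assms unfolding model_unitary_def by blast
  then show "fst (\<tau> x) \<in> hardy F" "snd (\<tau> x) \<in> K"
    by (auto simp: mem_Times_iff)
qed (use assms in \<open>auto simp: model_unitary_def\<close>)

lemma model_unitary_inj:
  assumes \<tau>: "model_unitary F K \<tau>" and eq: "\<tau> x = \<tau> y"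
  shows "x = y"
proof -
  have "cinner u x = cinner u y" for u
    using model_unitaryD(3)[OF \<tau>, of u x] model_unitaryD(3)[OF \<tau>, of u y] eq by simp
  then show ?thesis
    by (rule cinner_right_eqI)
qed

lemma intertwines_iff:
  "\<tau> \<circ> V = map_prod X W \<circ> \<tau> \<longleftrightarrow> (\<forall>h. \<tau> (V h) = (X (fst (\<tau> h)), W (snd (\<tau> h))))"
  by (auto simp: fun_eq_iff prod_eq_iff)

lemma bcl1_model_iff:
  "bcl1_model q V1 V2 F K P U W1 W2 \<tau> \<longleftrightarrow>
     bcl_tuple q F K P U W1 W2 \<and> model_unitary F K \<tau> \<and>
     (\<forall>h. \<tau> (V1 h) = (shift_op q (\<lambda>v. perp P (U v)) (\<lambda>v. P (U v)) (fst (\<tau> h)), W1 (snd (\<tau> h)))) \<and>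
     (\<forall>h. \<tau> (V2 h) = (shift_op (cnj q) (\<lambda>v. adj_on F U (P v))
        (\<lambda>v. cnj q *\<^sub>C adj_on F U (perp P v)) (fst (\<tau> h)), W2 (snd (\<tau> h))))"
  unfolding bcl1_model_def shift_op_eq intertwines_iff by (simp only: o_def)

lemma bcl2_model_iff:
  "bcl2_model q V1 V2 F K P U W1 W2 \<tau> \<longleftrightarrow>
     bcl_tuple q F K P U W1 W2 \<and> model_unitary F K \<tau> \<and>
     (\<forall>h. \<tau> (V1 h) = (shift_op q (\<lambda>v. adj_on F U (perp P v)) (\<lambda>v. adj_on F U (P v)) (fst (\<tau> h)),
        W1 (snd (\<tau> h)))) \<and>
     (\<forall>h. \<tau> (V2 h) = (shift_op (cnj q) (\<lambda>v. P (U v)) (\<lambda>v. cnj q *\<^sub>C perp P (U v)) (fst (\<tau> h)),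
        W2 (snd (\<tau> h))))"
  unfolding bcl2_model_def shift_op_eq intertwines_iff by (simp only: o_def)

lemma projection_onD:
  assumes F: "closed_csubspace F" and P: "projection_on F P"
  shows "bounded_op F P" "bounded_op F (perp P)"
    "x \<in> F \<Longrightarrow> P x \<in> F" "x \<in> F \<Longrightarrow> perp P x \<in> F"
    "x \<in> F \<Longrightarrow> P (P x) = P x" "x \<in> F \<Longrightarrow> P (perp P x) = 0"
    "x \<in> F \<Longrightarrow> y \<in> F \<Longrightarrow> cinner (P x) (perp P y) = 0"
    "x \<in> F \<Longrightarrow> y \<in> F \<Longrightarrow> cinner (perp P x) (P y) = 0"
    "x \<in> F \<Longrightarrow> (norm (P x))\<^sup>2 + (norm (perp P x))\<^sup>2 = (norm x)\<^sup>2"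
proof -
  show bP: "bounded_op F P"
    using P by (simp add: projection_on_def)
  then show "bounded_op F (perp P)"
    by (rule bounded_op_perp[OF F])
  then show perp: "x \<in> F \<Longrightarrow> perp P x \<in> F" for x
    by (rule bounded_opD(1))
  show "x \<in> F \<Longrightarrow> P x \<in> F"
    by (rule bounded_opD(1)[OF bP])
  show "x \<in> F \<Longrightarrow> P (P x) = P x"
    using P by (simp add: projection_on_def)
  show z: "x \<in> F \<Longrightarrow> P (perp P x) = 0" for x
    using P bounded_op_diff[OF F bP] bounded_opD(1)[OF bP] by (simp add: perp_def projection_on_def)
  show *: "x \<in> F \<Longrightarrow> y \<in> F \<Longrightarrow> cinner (P x) (perp P y) = 0" for x y
    using P z perp by (simp add: projection_on_def)
  then show "x \<in> F \<Longrightarrow> y \<in> F \<Longrightarrow> cinner (perp P x) (P y) = 0"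
    using cinner_eq_0_swap by blast
  show "x \<in> F \<Longrightarrow> (norm (P x))\<^sup>2 + (norm (perp P x))\<^sup>2 = (norm x)\<^sup>2"
    using pythagoras[OF *[of x x]] by (simp add: perp_def)
qed

section \<open>Calculus of an abstract model tuple\<close>

locale bcl_data =
  fixes q :: complex and F :: "'f::chilbert_space set" and K :: "'k::chilbert_space set"
    and P U W1 W2
  assumes q: "cmod q = 1" and tuple: "bcl_tuple q F K P U W1 W2"
begin

lemma F: "closed_csubspace F" and K: "closed_csubspace K" and P: "projection_on F P"
  and U: "unitary_on F U" and W1: "unitary_on K W1" and W2: "unitary_on K W2"
  and W: "k \<in> K \<Longrightarrow> W1 (W2 k) = q *\<^sub>C W2 (W1 k)"
  using tuple by (auto simp: bcl_tuple_def q_commuting_on_def)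

definition "Ua = adj_on F U"

lemma bounded_U: "bounded_op F U" and bounded_Ua: "bounded_op F Ua"
  using U unitary_on_adj(1)[OF F U] by (auto simp: unitary_on_def Ua_def)

lemma bounded_P: "bounded_op F P" and bounded_perp: "bounded_op F (perp P)"
  using projection_onD[OF F P] by auto

lemma mem: "v \<in> F \<Longrightarrow> U v \<in> F" "v \<in> F \<Longrightarrow> Ua v \<in> F" "v \<in> F \<Longrightarrow> P v \<in> F" "v \<in> F \<Longrightarrow> perp P v \<in> F"
  "v \<in> F \<Longrightarrow> w \<in> F \<Longrightarrow> v + w \<in> F" "v \<in> F \<Longrightarrow> c *\<^sub>C v \<in> F" "v \<in> F \<Longrightarrow> w \<in> F \<Longrightarrow> v - w \<in> F"
  using bounded_opD(1)[OF bounded_U] bounded_opD(1)[OF bounded_Ua] projection_onD(3,4)[OF F P]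
    closed_csubspaceD[OF F] by auto

lemmas linear =
  bounded_opD(2)[OF bounded_U] bounded_opD(2)[OF bounded_Ua] bounded_opD(2)[OF bounded_P]
  bounded_opD(2)[OF bounded_perp]
  bounded_opD(3)[OF bounded_U] bounded_opD(3)[OF bounded_Ua] bounded_opD(3)[OF bounded_P]
  bounded_opD(3)[OF bounded_perp]
  bounded_op_diff[OF F bounded_U] bounded_op_diff[OF F bounded_Ua] bounded_op_diff[OF F bounded_P]
  bounded_op_diff[OF F bounded_perp]

lemma U_Ua: "v \<in> F \<Longrightarrow> U (Ua v) = v" and Ua_U: "v \<in> F \<Longrightarrow> Ua (U v) = v"
  and adj_Ua: "v \<in> F \<Longrightarrow> adj_on F Ua v = U v"
  and U_adj: "v \<in> F \<Longrightarrow> w \<in> F \<Longrightarrow> cinner (U v) w = cinner v (Ua w)"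
  using unitary_on_adj[OF F U] by (auto simp: Ua_def)

lemma cinner_Ua: "v \<in> F \<Longrightarrow> w \<in> F \<Longrightarrow> cinner (Ua v) (Ua w) = cinner v w"
  using U_adj[of "Ua v" w] mem U_Ua by simp

lemma norm_U: "v \<in> F \<Longrightarrow> norm (U v) = norm v" and norm_Ua: "v \<in> F \<Longrightarrow> norm (Ua v) = norm v"
  using U cinner_Ua by (auto simp: unitary_on_def intro!: norm_eq_of_cinner)

lemma P_simps: "v \<in> F \<Longrightarrow> P (P v) = P v" "v \<in> F \<Longrightarrow> P (perp P v) = 0"
  "v \<in> F \<Longrightarrow> perp P (P v) = 0" "v \<in> F \<Longrightarrow> perp P (perp P v) = perp P v"
  using projection_onD(5,6)[OF F P] by (auto simp: perp_def)

lemma P_add_perp: "P v + perp P v = v" "perp P v + P v = v"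
  by (simp_all add: perp_def)

lemma P_orth:
  "v \<in> F \<Longrightarrow> w \<in> F \<Longrightarrow> cinner (P v) (perp P w) = 0" "v \<in> F \<Longrightarrow> w \<in> F \<Longrightarrow> cinner (perp P v) (P w) = 0"
  "v \<in> F \<Longrightarrow> (norm (P v))\<^sup>2 + (norm (perp P v))\<^sup>2 = (norm v)\<^sup>2"
  using projection_onD[OF F P] by auto

text \<open>The two weights of each block have orthogonal ranges and squared norms adding up, so
  \<open>hardy_inner_shift_op\<close> gives isometries. On the Hardy part both products of the
  blocks are scalar multiples of multiplication by \<open>z\<close>, and \<open>\<tau>\<close> is
  injective.\<close>

lemma q_isometric_pair_of_bcl1:
  assumes model: "bcl1_model q V1 V2 F K P U W1 W2 \<tau>"
    and V1: "bounded_op UNIV V1" and V2: "bounded_op UNIV V2"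
  shows "q_isometric_pair q V1 V2"
proof -
  define A where "A = (\<lambda>v. perp P (U v))"
  define B where "B = (\<lambda>v. P (U v))"
  define C where "C = (\<lambda>v. Ua (P v))"
  define D where "D = (\<lambda>v. cnj q *\<^sub>C Ua (perp P v))"
  have \<tau>: "model_unitary F K \<tau>"
    and \<tau>1: "\<tau> (V1 h) = (shift_op q A B (fst (\<tau> h)), W1 (snd (\<tau> h)))"
    and \<tau>2: "\<tau> (V2 h) = (shift_op (cnj q) C D (fst (\<tau> h)), W2 (snd (\<tau> h)))" for h
    using model by (auto simp: bcl1_model_iff A_def B_def C_def D_def Ua_def)
  note D\<tau> = model_unitaryD[OF \<tau>]
  have bdd: "bounded_op F A" "bounded_op F B" "bounded_op F C" "bounded_op F D"
    using bounded_op_compose[OF bounded_perp bounded_U] bounded_op_compose[OF bounded_P bounded_U]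
      bounded_op_compose[OF bounded_Ua bounded_P]
      bounded_op_scaleC[OF F bounded_op_compose[OF bounded_Ua bounded_perp], of "cnj q"]
    by (simp_all add: A_def B_def C_def D_def comp_def)
  have "hardy_inner (shift_op q A B (fst (\<tau> h))) (shift_op q A B (fst (\<tau> h)))
      = hardy_inner (fst (\<tau> h)) (fst (\<tau> h))" for h
    using q F bdd(1,2) _ _ D\<tau>(1)
    by (rule hardy_inner_shift_op)
      (simp_all add: A_def B_def P_orth mem norm_U, metis P_orth(3) add.commute mem(1) norm_U)
  moreover have "hardy_inner (shift_op (cnj q) C D (fst (\<tau> h))) (shift_op (cnj q) C D (fst (\<tau> h)))
      = hardy_inner (fst (\<tau> h)) (fst (\<tau> h))" for h
    using _ F bdd(3,4) _ _ D\<tau>(1)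
    by (rule hardy_inner_shift_op)
      (simp_all add: q C_def D_def cinner_scaleC_right cinner_Ua norm_scaleC norm_Ua P_orth mem)
  moreover have "cinner (W1 (snd (\<tau> h))) (W1 (snd (\<tau> h))) = cinner (snd (\<tau> h)) (snd (\<tau> h))"
    "cinner (W2 (snd (\<tau> h))) (W2 (snd (\<tau> h))) = cinner (snd (\<tau> h)) (snd (\<tau> h))" for h
    using W1 W2 D\<tau>(2) by (auto simp: unitary_on_def)
  ultimately have "cinner (V1 h) (V1 h) = cinner h h" "cinner (V2 h) (V2 h) = cinner h h" for h
    using D\<tau>(3)[of "V1 h" "V1 h"] D\<tau>(3)[of "V2 h" "V2 h"] D\<tau>(3)[of h h] by (simp_all add: \<tau>1 \<tau>2)
  then have "norm (V1 h) = norm h" "norm (V2 h) = norm h" for h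
    using norm_eq_of_cinner by blast+
  moreover have "V1 (V2 h) = q *\<^sub>C V2 (V1 h)" for h
  proof (rule model_unitary_inj[OF \<tau>])
    define f where "f = fst (\<tau> h)"
    have f: "f z \<in> F" for z
      using hardyD(1)[OF F D\<tau>(1)] by (simp add: f_def)
    note qq = scaleC_cancel_unimodular[OF q]
    have "q * cnj q = 1"
      using q by (simp add: complex_norm_square[symmetric])
    then have qc: "q * (cnj q * z) = z" "cnj q * (q * z) = z" "q * z * cnj q = z" for z
      by (metis mult.assoc mult.commute mult_1)+
    have "shift_op q A B (shift_op (cnj q) C D f) z = z *\<^sub>C f z" for z
    proof -
      \<comment> \<open>The rotation by \<open>q\<close> undoes the one by \<open>cnj q\<close>, so
        only the value \<open>f z\<close> occurs; the factor \<open>cnj q\<close> in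
        \<open>D\<close> cancels the \<open>q\<close> of the argument.\<close>
      have g: "shift_op (cnj q) C D f (q * z) = Ua (P (f z) + z *\<^sub>C perp P (f z))"
        using f by (simp add: shift_op_def C_def D_def linear mem scaleC_scaleC qc)
      show ?thesis
        unfolding shift_op_def[of q] g A_def B_def
        using f by (simp add: U_Ua mem linear P_simps P_add_perp flip: scaleC_add_right)
    qed
    moreover have "shift_op (cnj q) C D (shift_op q A B f) z = cnj q *\<^sub>C z *\<^sub>C f z" for z
    proof -
      have g: "shift_op q A B f (cnj q * z) = perp P (U (f z)) + (cnj q * z) *\<^sub>C P (U (f z))"
        by (simp add: shift_op_def A_def B_def qc)
      have "shift_op (cnj q) C D (shift_op q A B f) z
          = (cnj q * z) *\<^sub>C (Ua (P (U (f z))) + Ua (perp P (U (f z))))"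
        unfolding shift_op_def[of "cnj q"] g C_def D_def using f
        by (simp add: mem linear P_simps scaleC_scaleC mult.commute scaleC_add_right)
      also have "\<dots> = (cnj q * z) *\<^sub>C f z"
        using f by (simp add: linear(2)[symmetric] mem P_add_perp Ua_U)
      finally show ?thesis
        by (simp add: scaleC_scaleC)
    qed
    ultimately show "\<tau> (V1 (V2 h)) = \<tau> (q *\<^sub>C V2 (V1 h))"
      using W[OF D\<tau>(2)[of h]] by (simp add: \<tau>1 \<tau>2 D\<tau>(4) qq fun_eq_iff flip: f_def)
  qed
  ultimately show ?thesis
    using V1 V2 by (simp add: q_isometric_pair_def isometry_on_def q_commuting_on_def)
qed

lemma bcl_tuple_conj: "bcl_tuple q F K (adj_on F U \<circ> P \<circ> U) (adj_on F U) W1 W2"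
proof -
  have "projection_on F (Ua \<circ> P \<circ> U)"
  proof -
    have "cinner (Ua (P (U x))) y = cinner x (Ua (P (U y)))" if "x \<in> F" "y \<in> F" for x y
    proof -
      have "cinner (Ua (P (U x))) y = cinner (P (U x)) (U y)"
        using that mem U_adj[of y "P (U x)"] by (metis cinner_commute)
      also have "\<dots> = cinner (U x) (P (U y))"
        using P that mem by (simp add: projection_on_def)
      finally show ?thesis
        using that mem U_adj by simp
    qed
    then show ?thesis
      using bounded_op_compose[OF bounded_op_compose[OF bounded_Ua bounded_P] bounded_U]
      by (simp add: projection_on_def U_Ua mem P_simps)
  qed
  then show ?thesis
    using tuple unitary_on_adj(1)[OF F U] by (simp add: bcl_tuple_def Ua_def)
qed

text \<open>Conjugating \<open>P\<close> by \<open>U\<close> and replacing \<open>U\<close> by its adjoint interchanges the two models.\<close>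

lemma conj_ops:
  assumes "v \<in> F"
  shows "perp (Ua \<circ> P \<circ> U) (Ua v) = Ua (perp P v)" "(Ua \<circ> P \<circ> U) (Ua v) = Ua (P v)"
    "adj_on F Ua ((Ua \<circ> P \<circ> U) v) = P (U v)" "adj_on F Ua (perp (Ua \<circ> P \<circ> U) v) = perp P (U v)"
  using assms by (simp_all add: perp_def adj_Ua U_Ua mem linear)

lemma bcl1_imp_bcl2:
  assumes "bcl1_model q V1 V2 F K P U W1 W2 \<tau>"
  shows "bcl2_model q V1 V2 F K (adj_on F U \<circ> P \<circ> U) (adj_on F U) W1 W2 \<tau>"
proof -
  have \<tau>: "model_unitary F K \<tau>"
    using assms by (simp add: bcl1_model_iff)
  have f: "fst (\<tau> h) z \<in> F" for h z
    by (rule hardyD(1)[OF F model_unitaryD(1)[OF \<tau>]])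
  show ?thesis
    using assms bcl_tuple_conj unfolding bcl1_model_iff bcl2_model_iff Ua_def[symmetric]
    by (auto intro!: shift_op_cong[where F = F] f simp: conj_ops simp del: o_apply)
qed

lemma bcl2_imp_bcl1:
  assumes "bcl2_model q V1 V2 F K P U W1 W2 \<tau>"
  shows "bcl1_model q V1 V2 F K (adj_on F U \<circ> P \<circ> U) (adj_on F U) W1 W2 \<tau>"
proof -
  have \<tau>: "model_unitary F K \<tau>"
    using assms by (simp add: bcl2_model_iff)
  have f: "fst (\<tau> h) z \<in> F" for h z
    by (rule hardyD(1)[OF F model_unitaryD(1)[OF \<tau>]])
  show ?thesis
    using assms bcl_tuple_conj unfolding bcl1_model_iff bcl2_model_iff Ua_def[symmetric]
    by (auto intro!: shift_op_cong[where F = F] f simp: conj_ops simp del: o_apply)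
qed

lemma hardy_pointwise:
  assumes A: "bounded_op F A" and A_le: "\<And>v. v \<in> F \<Longrightarrow> norm (A v) = norm v" and f: "f \<in> hardy F"
  shows "(\<lambda>z. A (f z)) \<in> hardy F" "taylor_coeff (\<lambda>z. A (f z)) = (\<lambda>n. A (taylor_coeff f n))"
proof -
  note h = hardyD[OF F f]
  have ps: "power_series_on_disk (\<lambda>n. A (taylor_coeff f n)) (\<lambda>z. A (f z))"
    by (rule power_series_on_disk_pointwise[OF F A h(4,3)])
  show "(\<lambda>z. A (f z)) \<in> hardy F"
    using h A_le bounded_opD(1)[OF A] bounded_op_0[OF F A] by (intro hardyI[OF _ _ _ ps]) simp_all
  show "taylor_coeff (\<lambda>z. A (f z)) = (\<lambda>n. A (taylor_coeff f n))"
    by (rule taylor_coeff_eqI[OF ps])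
qed

text \<open>Applying \<open>U\<close> pointwise means applying it to every Taylor coefficient, which
  preserves the inner product; applying \<open>Ua\<close> pointwise is the inverse.\<close>

lemma model_unitary_rotate:
  assumes \<tau>: "model_unitary F K \<tau>"
  shows "model_unitary F K (map_prod (id \<otimes>\<^sub>H U) id \<circ> \<tau>)"
proof -
  note D\<tau> = model_unitaryD[OF \<tau>]
  have fF: "fst (\<tau> x) z \<in> F" for x z
    by (rule hardyD(1)[OF F D\<tau>(1)])
  have "range \<tau> = hardy F \<times> K"
    using \<tau> by (simp only: model_unitary_def)
  then have "range (map_prod (id \<otimes>\<^sub>H U) id \<circ> \<tau>) = map_prod (id \<otimes>\<^sub>H U) id ` (hardy F \<times> K)"
    by (simp only: image_comp[symmetric])
  also have "\<dots> = hardy F \<times> K"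
  proof -
    have "(id \<otimes>\<^sub>H U) ` hardy F = hardy F"
    proof
      show "(id \<otimes>\<^sub>H U) ` hardy F \<subseteq> hardy F"
        using hardy_pointwise(1)[OF bounded_U norm_U] by (auto simp: tensor_op_def)
      show "hardy F \<subseteq> (id \<otimes>\<^sub>H U) ` hardy F"
      proof
        fix f assume f: "f \<in> hardy F"
        have "f = (id \<otimes>\<^sub>H U) (\<lambda>z. Ua (f z))"
          using hardyD(1)[OF F f] U_Ua by (simp add: tensor_op_def fun_eq_iff)
        then show "f \<in> (id \<otimes>\<^sub>H U) ` hardy F"
          using hardy_pointwise(1)[OF bounded_Ua norm_Ua f] by blast
      qed
    qed
    then show ?thesis
      by (simp add: map_prod_surj_on)
  qed
  finally have "range (map_prod (id \<otimes>\<^sub>H U) id \<circ> \<tau>) = hardy F \<times> K" .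
  moreover have "hardy_inner ((id \<otimes>\<^sub>H U) (fst (\<tau> x))) ((id \<otimes>\<^sub>H U) (fst (\<tau> y)))
      = hardy_inner (fst (\<tau> x)) (fst (\<tau> y))" for x y
    using U hardyD(4)[OF F D\<tau>(1)]
    by (simp add: hardy_inner_def tensor_op_def hardy_pointwise(2)[OF bounded_U norm_U D\<tau>(1)]
        unitary_on_def)
  ultimately show ?thesis
    using \<tau> fF by (simp add: model_unitary_def tensor_op_def linear)
qed

text \<open>Conjugation by \<open>U\<close> turns \<open>perp P \<circ> U\<close> into
  \<open>U \<circ> perp P\<close>, the weight of the second model for the unitary
  \<open>adj_on F U\<close>. The price of keeping \<open>P\<close> is a changed implementing
  unitary.\<close>

lemma bcl1_imp_bcl2_rotated:
  assumes "bcl1_model q V1 V2 F K P U W1 W2 \<tau>"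
  shows "bcl2_model q V1 V2 F K P (adj_on F U) W1 W2 (map_prod (id \<otimes>\<^sub>H U) id \<circ> \<tau>)"
proof -
  have \<tau>: "model_unitary F K \<tau>"
    using assms by (simp add: bcl1_model_iff)
  have f: "fst (\<tau> h) z \<in> F" for h z
    by (rule hardyD(1)[OF F model_unitaryD(1)[OF \<tau>]])
  have "bcl_tuple q F K P Ua W1 W2"
    using tuple unitary_on_adj(1)[OF F U] by (simp add: bcl_tuple_def Ua_def)
  then show ?thesis
    using assms model_unitary_rotate[OF \<tau>] f
    unfolding bcl1_model_iff bcl2_model_iff Ua_def[symmetric]
    by (simp add: fun_eq_iff tensor_op_def shift_op_def adj_Ua U_Ua Ua_U mem linear)
qed

end

lemma q_isometric_pair_of_model:
  assumes q: "cmod q = 1" and V: "bounded_op UNIV V1" "bounded_op UNIV V2"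
    and model: "bcl1_model q V1 V2 F K P U W1 W2 \<tau> \<or> bcl2_model q V1 V2 F K P U W1 W2 \<tau>"
  shows "q_isometric_pair q V1 V2"
proof -
  \<comment> \<open>\<open>P\<close> and \<open>U\<close> are generalised because the second model
    is reduced to a first model with conjugated projection and inverted unitary.\<close>
  have 1: "q_isometric_pair q V1 V2" if "bcl1_model q V1 V2 F K P U W1 W2 \<tau>" for P U
    using bcl_data.q_isometric_pair_of_bcl1[OF bcl_data.intro that V] q that
    by (simp add: bcl1_model_iff)
  show ?thesis
    using model
  proof
    assume 2: "bcl2_model q V1 V2 F K P U W1 W2 \<tau>"
    then have "bcl_data q F K P U W1 W2"
      using q by (simp add: bcl2_model_iff bcl_data_def)
    from bcl_data.bcl2_imp_bcl1[OF this 2] show ?thesis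
      by (rule 1)
  qed (rule 1)
qed

section \<open>The explicit model\<close>

context hilbert_isometry
begin

lemma defect_adj_add: "defect (cadj V) (x + y) = defect (cadj V) x + defect (cadj V) y"
  and defect_adj_scaleC: "defect (cadj V) (c *\<^sub>C x) = c *\<^sub>C defect (cadj V) x"
  and defect_adj_range: "defect (cadj V) (V x) = 0"
  and adj_defect_adj: "cadj V (defect (cadj V) x) = 0"
  and defect_adj_ident: "cadj V x = 0 \<Longrightarrow> defect (cadj V) x = x"
  by (simp_all add: defect_adj add adj_add scaleC adj_scaleC scaleC_diff_right adj_diff adj_zero
      adj_left_inverse zero)

text \<open>The defect operator is a projection with range orthogonal to that of \<open>V\<close>,
  so one of its two copies may be dropped.\<close>

lemma cinner_defect_adj:
  "cinner (defect (cadj V) x) (defect (cadj V) y) = cinner x y - cinner (cadj V x) (cadj V y)"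
proof -
  have "cinner (defect (cadj V) x) (V (cadj V y)) = 0"
    using cinner_adj_left[of "defect (cadj V) x" "cadj V y"] by (simp add: adj_defect_adj)
  then have "cinner (defect (cadj V) x) (defect (cadj V) y) = cinner (defect (cadj V) x) y"
    by (simp add: defect_adj cinner_diff_right)
  then show ?thesis
    by (simp add: defect_adj cinner_diff_left cinner_adj_right)
qed

lemma funpow_isometry: "hilbert_isometry (V ^^ n)" "cadj (V ^^ n) = cadj V ^^ n"
proof (induction n)
  case 0
  case 1
  have "bounded_op UNIV (\<lambda>x::'a. x)"
    by (rule bounded_op_norm_le) simp_all
  then show ?case
    by unfold_locales (simp add: isometry_on_def id_def)
  case 2
  show ?case
    by (rule ext, rule adj_on_eqI) simp_all
next
  case (Suc n)
  case 1
  show ?case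
    using hilbert_isometry_compose(1)[OF hilbert_isometry_axioms Suc(1)] by (simp only: funpow.simps(2))
  case 2
  show ?case
    \<comment> \<open>Adjoints reverse the order, so powers of \<open>V\<close> are unfolded on the
      left and those of \<open>cadj V\<close> on the right.\<close>
    using hilbert_isometry_compose(2)[OF hilbert_isometry_axioms Suc(1)] Suc(2)
    by (simp only: funpow.simps(2)[of n V] funpow_Suc_right[of n "cadj V"])
qed

end

section \<open>Commutation relations of the pair and its adjoints\<close>

locale q_isometries =
  fixes q :: complex and V1 V2 :: "'a::chilbert_space \<Rightarrow> 'a"
  assumes q: "cmod q = 1" and pair: "q_isometric_pair q V1 V2"
begin

definition V where "V = V1 \<circ> V2"

sublocale V1: hilbert_isometry V1
  using pair by unfold_locales (simp add: q_isometric_pair_def)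

sublocale V2: hilbert_isometry V2
  using pair by unfold_locales (simp add: q_isometric_pair_def)

sublocale V: hilbert_isometry V
  unfolding V_def
  by (rule hilbert_isometry_compose(1)[OF V1.hilbert_isometry_axioms V2.hilbert_isometry_axioms])

abbreviation "A1 \<equiv> cadj V1"
abbreviation "A2 \<equiv> cadj V2"
abbreviation "Va \<equiv> cadj V"
abbreviation "D1 \<equiv> defect A1"
abbreviation "D2 \<equiv> defect A2"
abbreviation "F \<equiv> bcl_F V1 V2"
abbreviation "K \<equiv> bcl_K V1 V2"

lemma V_apply: "V x = V1 (V2 x)" and Va_apply: "Va x = A2 (A1 x)"
  using hilbert_isometry_compose(2)[OF V1.hilbert_isometry_axioms V2.hilbert_isometry_axioms]
  by (simp_all add: V_def)

lemma q_cnj: "q * cnj q = 1" "cnj q * q = 1"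
  using q by (simp_all add: complex_norm_square[symmetric] mult.commute[of "cnj q"])

lemma comm: "V1 (V2 x) = q *\<^sub>C V2 (V1 x)" and comm': "V2 (V1 x) = cnj q *\<^sub>C V1 (V2 x)"
proof -
  show c: "V1 (V2 x) = q *\<^sub>C V2 (V1 x)"
    using pair by (simp add: q_isometric_pair_def q_commuting_on_def)
  show "V2 (V1 x) = cnj q *\<^sub>C V1 (V2 x)"
    by (simp add: c scaleC_scaleC q_cnj)
qed

text \<open>The adjoint of \<open>comm'\<close>: its factor \<open>cnj q\<close> is conjugated back
  to \<open>q\<close> on passing to the second argument of the inner product.\<close>

lemma adj_comm: "A1 (A2 x) = q *\<^sub>C Va x"
proof (rule cinner_right_eqI)
  fix u
  have "cinner u (A1 (A2 x)) = cinner (V2 (V1 u)) x"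
    by (simp add: V1.cinner_adj_right V2.cinner_adj_right)
  also have "\<dots> = cinner u (q *\<^sub>C Va x)"
    by (simp add: comm' cinner_linear V.cinner_adj_right flip: V_apply)
  finally show "cinner u (A1 (A2 x)) = cinner u (q *\<^sub>C Va x)" .
qed

lemma Va_V1: "Va (V1 x) = A2 x"
  by (simp add: Va_apply V1.adj_left_inverse)

text \<open>\<open>Va\<close> is rewritten through \<open>A1\<close> and \<open>A2\<close> in the
  opposite order, so that \<open>A2\<close> meets \<open>V2\<close> and cancels it.\<close>

lemma Va_V2: "Va (V2 x) = cnj q *\<^sub>C A1 x"
proof -
  have "cnj q *\<^sub>C A1 (A2 (V2 x)) = Va (V2 x)"
    by (simp add: adj_comm scaleC_scaleC q_cnj)
  then show ?thesis
    by (simp add: V2.adj_left_inverse)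
qed

lemma Va_A2: "Va (A2 x) = q *\<^sub>C A2 (Va x)"
  by (simp add: Va_apply[of "A2 x"] adj_comm V2.adj_scaleC)

lemma Va_A1: "Va (A1 x) = cnj q *\<^sub>C A1 (Va x)"
proof -
  have "cnj q *\<^sub>C A1 (A2 (A1 x)) = Va (A1 x)"
    by (simp add: adj_comm scaleC_scaleC q_cnj)
  then show ?thesis
    by (simp add: Va_apply[of x])
qed

lemma Va_pow_A2: "(Va ^^ n) (A2 x) = q ^ n *\<^sub>C A2 ((Va ^^ n) x)"
  by (induction n) (simp_all add: V.adj_scaleC Va_A2 scaleC_scaleC mult.commute)

lemma Va_pow_A1: "(Va ^^ n) (A1 x) = cnj q ^ n *\<^sub>C A1 ((Va ^^ n) x)"
  by (induction n) (simp_all add: V.adj_scaleC Va_A1 scaleC_scaleC mult.commute)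

text \<open>One factor \<open>Va\<close> absorbs \<open>V1\<close> and leaves \<open>A2\<close>;
  only the other \<open>n\<close> factors are commuted past it, hence the exponent \<open>n\<close>.
  In \<open>Va_pow_V2\<close> the absorption itself costs one more \<open>cnj q\<close>.\<close>

lemma Va_pow_V1: "(Va ^^ Suc n) (V1 x) = q ^ n *\<^sub>C A2 ((Va ^^ n) x)"
  by (simp only: funpow_Suc_right o_apply Va_V1 Va_pow_A2)

lemma Va_pow_scaleC: "(Va ^^ n) (c *\<^sub>C x) = c *\<^sub>C (Va ^^ n) x"
  by (induction n) (simp_all add: V.adj_scaleC)

lemma Va_pow_V2: "(Va ^^ Suc n) (V2 x) = cnj q ^ Suc n *\<^sub>C A1 ((Va ^^ n) x)"
  by (simp only: funpow_Suc_right o_apply Va_V2 Va_pow_scaleC Va_pow_A1) (simp add: scaleC_scaleC)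

subsection \<open>The coefficient space\<close>

definition col where "col h = (D1 h, D2 (A1 h))"

text \<open>A right inverse of \<open>col\<close> on \<open>F\<close>, with values in the kernel of
  \<open>Va\<close>.\<close>

definition lift :: "'a \<times> 'a \<Rightarrow> 'a" where "lift v = fst v + V1 (snd v)"

definition rot where "rot h = (D1 (A2 h), D2 h)"

text \<open>As \<open>col\<close> maps onto \<open>F\<close>, the requirement
  \<open>U (col h) = rot h\<close> determines \<open>U\<close> on \<open>F\<close>, and
  \<open>lift\<close> selects a preimage. The choice is immaterial because \<open>rot\<close>
  vanishes on the range of \<open>V\<close>.\<close>

definition U where "U v = rot (lift v)"

lemma F_eq: "F = {v. A1 (fst v) = 0 \<and> A2 (snd v) = 0}"
  by (auto simp: bcl_F_def V1.defect_space_adj V2.defect_space_adj)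

lemma closed_F: "closed_csubspace F"
  unfolding bcl_F_def
  by (intro closed_csubspace_Times V1.closed_csubspace_defect_space V2.closed_csubspace_defect_space)

lemma col_in_F: "col h \<in> F" and rot_in_F: "rot h \<in> F"
  by (simp_all add: F_eq col_def rot_def V1.adj_defect_adj V2.adj_defect_adj)

lemma col_add: "col (x + y) = col x + col y" and col_scaleC: "col (c *\<^sub>C x) = c *\<^sub>C col x"
  and rot_add: "rot (x + y) = rot x + rot y" and rot_scaleC: "rot (c *\<^sub>C x) = c *\<^sub>C rot x"
  and lift_add: "lift (v + w) = lift v + lift w" and lift_scaleC: "lift (c *\<^sub>C v) = c *\<^sub>C lift v"
  by (simp_all add: col_def rot_def lift_def scaleC_prod_def V1.adj_add V2.adj_add V1.adj_scaleC
      V2.adj_scaleC V1.add V1.scaleC V1.defect_adj_add V2.defect_adj_add V1.defect_adj_scaleC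
      V2.defect_adj_scaleC scaleC_add_right)

lemma col_lift: "v \<in> F \<Longrightarrow> col (lift v) = v"
  by (simp add: F_eq col_def lift_def V1.defect_adj_add V1.defect_adj_ident V1.defect_adj_range
      V1.adj_add V1.adj_left_inverse V2.defect_adj_ident)

lemma Va_lift: "v \<in> F \<Longrightarrow> Va (lift v) = 0"
  by (simp add: F_eq Va_apply lift_def V1.adj_add V1.adj_left_inverse)

lemma col_V: "col (V x) = 0"
  by (simp add: col_def V_apply V1.defect_adj_range V1.adj_left_inverse V2.defect_adj_range zero_prod_def)

lemma rot_V: "rot (V x) = 0"
  by (simp add: rot_def V_apply comm V2.adj_scaleC V2.adj_left_inverse V1.defect_adj_scaleC
      V1.defect_adj_range V2.defect_adj_scaleC V2.defect_adj_range zero_prod_def)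

text \<open>Splits off the component of \<open>h\<close> in the range of \<open>V\<close>: the
  complementary projection is \<open>D1 + V1 D2 A1\<close>.\<close>

lemma lift_col: "h = lift (col h) + V (Va h)"
  by (simp add: lift_def col_def V1.defect_adj V2.defect_adj V_apply Va_apply V1.diff)

text \<open>The two defect identities contribute \<open>cinner (A1 x) (A1 y)\<close> with opposite
  signs.\<close>

lemma cinner_col: "cinner (col x) (col y) = cinner x y - cinner (Va x) (Va y)"
  by (simp add: col_def cinner_prod_def V1.cinner_defect_adj V2.cinner_defect_adj Va_apply)

text \<open>The same cancellation, now through \<open>A2\<close>; the remaining
  \<open>A1 (A2 x)\<close> is a unimodular multiple of \<open>Va x\<close>.\<close>

lemma cinner_rot: "cinner (rot x) (rot y) = cinner x y - cinner (Va x) (Va y)"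
proof -
  have "cinner (A1 (A2 x)) (A1 (A2 y)) = (q * cnj q) * cinner (Va x) (Va y)"
    by (simp add: adj_comm cinner_linear)
  then show ?thesis
    by (simp add: rot_def cinner_prod_def V1.cinner_defect_adj V2.cinner_defect_adj q_cnj)
qed

lemma U_col: "U (col h) = rot h"
proof -
  have "rot h = rot (lift (col h)) + rot (V (Va h))"
    by (subst lift_col) (rule rot_add)
  then show ?thesis
    by (simp add: U_def rot_V)
qed

lemma cinner_lift:
  assumes "v \<in> F" "w \<in> F"
  shows "cinner (lift v) (lift w) = cinner v w"
  using cinner_col[of "lift v" "lift w"] assms by (simp add: col_lift Va_lift)

lemma unitary_U: "unitary_on F U"
proof -
  have iso: "cinner (U v) (U w) = cinner v w" if "v \<in> F" "w \<in> F" for v w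
    using that by (simp add: U_def cinner_rot Va_lift cinner_lift)
  have "bounded_op F U"
  proof (rule bounded_opI[where b = 1])
    show "norm (U v) \<le> 1 * norm v" if "v \<in> F" for v
      using norm_eq_of_cinner[OF iso[OF that that]] by simp
  qed (simp_all add: U_def rot_in_F lift_add rot_add lift_scaleC rot_scaleC)
  moreover have "U ` F = F"
  proof
    show "U ` F \<subseteq> F"
      by (auto simp: U_def rot_in_F)
    show "F \<subseteq> U ` F"
    proof
      fix v assume v: "v \<in> F"
      \<comment> \<open>The mirror image of \<open>lift\<close> with \<open>V1\<close> and
        \<open>V2\<close> exchanged, a right inverse of \<open>rot\<close> on
        \<open>F\<close>.\<close>
      define h where "h = V2 (fst v) + snd v"
      have "rot h = v"
        using v by (simp add: F_eq rot_def h_def V2.adj_add V2.adj_left_inverse V1.defect_adj_ident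
            V2.defect_adj_add V2.defect_adj_range V2.defect_adj_ident)
      then have "v = U (col h)"
        by (simp add: U_col)
      then show "v \<in> U ` F"
        using col_in_F by blast
    qed
  qed
  ultimately show ?thesis
    using iso by (simp add: unitary_on_def)
qed

lemma is_bcl_U: "is_bcl_U V1 V2 U"
  using unitary_U U_col by (simp add: is_bcl_U_def col_def rot_def)

lemma projection_bcl_P: "projection_on F bcl_P"
proof -
  have "bounded_op F bcl_P"
  proof (rule bounded_opI[where b = 1])
    show "norm (bcl_P v) \<le> 1 * norm v" for v :: "'a \<times> 'a"
      by (cases v) (simp add: bcl_P_def norm_Pair real_le_rsqrt)
  qed (auto simp: F_eq bcl_P_def V2.adj_zero scaleC_prod_def)
  then show ?thesis
    by (simp add: projection_on_def bcl_P_def cinner_prod_def split_beta)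
qed

subsection \<open>The unitary part\<close>

lemma V_pow: "hilbert_isometry (V ^^ n)" "cadj (V ^^ n) = Va ^^ n"
  by (rule V.funpow_isometry)+

lemma Va_pow_V_pow: "(Va ^^ n) ((V ^^ n) x) = x"
  using hilbert_isometry.adj_left_inverse[OF V_pow(1)] by (simp add: V_pow(2))

lemma cinner_V_pow: "cinner ((V ^^ n) x) y = cinner x ((Va ^^ n) y)"
  using hilbert_isometry.cinner_adj_right[OF V_pow(1)] by (simp add: V_pow(2))

lemma K_eq: "K = (\<Inter>n. range (V ^^ n))"
  by (simp add: bcl_K_def V_def)

lemma closed_K: "closed_csubspace K"
proof -
  note R = hilbert_isometry.closed_csubspace_range[OF V_pow(1)]
  show ?thesis
    unfolding closed_csubspace_def K_eq
    by (intro conjI ballI allI closed_INT InterI ballI)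
      (auto intro: closed_csubspaceD[OF R] simp: image_iff[symmetric] simp del: funpow.simps)
qed

lemma KD: "k \<in> K \<Longrightarrow> \<exists>x. k = (V ^^ n) x"
  unfolding K_eq by blast

lemma KI: "(\<And>n. k \<in> range (V ^^ n)) \<Longrightarrow> k \<in> K"
  unfolding K_eq by blast

text \<open>The projection onto the range of \<open>V ^^ n\<close>. These ranges decrease to
  \<open>K\<close>, and the limit \<open>Q\<close> is the projection onto \<open>K\<close>.\<close>

definition E where "E n h = (V ^^ n) ((Va ^^ n) h)"

definition Q where "Q h = lim (\<lambda>n. E n h)"

text \<open>Factoring out \<open>V ^^ n\<close> leaves the defect of \<open>V ^^ k\<close> at
  \<open>(Va ^^ n) h\<close>, whose norm is given by \<open>norm_adj\<close>.\<close>

lemma norm_E_diff: "(norm (E n h - E (n + k) h))\<^sup>2 = (norm ((Va ^^ n) h))\<^sup>2 - (norm ((Va ^^ (n + k)) h))\<^sup>2"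
proof -
  interpret n: hilbert_isometry "V ^^ n" by (rule V_pow(1))
  interpret k: hilbert_isometry "V ^^ k" by (rule V_pow(1))
  define x where "x = (Va ^^ n) h"
  have x: "(Va ^^ (n + k)) h = (Va ^^ k) x"
    unfolding x_def by (metis add.commute comp_apply funpow_add)
  have "E (n + k) h = (V ^^ n) ((V ^^ k) ((Va ^^ k) x))"
    by (simp add: E_def x) (simp add: funpow_add)
  then have "E n h - E (n + k) h = (V ^^ n) (x - (V ^^ k) ((Va ^^ k) x))"
    by (simp add: n.diff E_def x_def)
  then have "norm (E n h - E (n + k) h) = norm (x - (V ^^ k) ((Va ^^ k) x))"
    by (simp only: n.norm)
  then show ?thesis
    using k.norm_adj[of x] unfolding x V_pow(2) by (simp add: x_def)
qed

text \<open>By \<open>norm_E_diff\<close> squared distances are differences of a decreasing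
  nonnegative sequence, which is Cauchy.\<close>

lemma E_tendsto_Q: "(\<lambda>n. E n h) \<longlonglongrightarrow> Q h"
proof -
  define s where "s n = (norm ((Va ^^ n) h))\<^sup>2" for n
  have "s (Suc n) \<le> s n" for n
    using V.norm_adj_le by (simp add: s_def power_mono)
  then have "decseq s"
    by (simp add: decseq_Suc_iff)
  moreover have "\<And>n. 0 \<le> s n"
    by (simp add: s_def)
  ultimately have "Cauchy s"
    using decseq_convergent[of s 0] convergentI LIMSEQ_imp_Cauchy by metis
  have "Cauchy (\<lambda>n. E n h)"
  proof (rule CauchyI')
    fix e :: real assume e: "0 < e"
    then obtain N where N: "\<And>m n. m \<ge> N \<Longrightarrow> n \<ge> N \<Longrightarrow> dist (s m) (s n) < e\<^sup>2"
      using \<open>Cauchy s\<close> unfolding Cauchy_def by (meson zero_less_power)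
    have "dist (E m h) (E n h) < e" if mn: "m \<ge> N" "n > m" for m n
    proof (rule power2_less_imp_less)
      obtain k where k: "n = m + k"
        using le_Suc_ex[OF less_imp_le[OF mn(2)]] by blast
      have "dist (s m) (s n) < e\<^sup>2"
        using N mn by simp
      then show "(dist (E m h) (E n h))\<^sup>2 < e\<^sup>2"
        unfolding dist_norm real_norm_def k norm_E_diff s_def by linarith
    qed (use e in simp)
    then show "\<exists>M. \<forall>m\<ge>M. \<forall>n>m. dist (E m h) (E n h) < e"
      by blast
  qed
  then show ?thesis
    unfolding Q_def by (simp add: Cauchy_convergent_iff convergent_LIMSEQ_iff)
qed

text \<open>From index \<open>n\<close> on, the sequence lies in the closed range of
  \<open>V ^^ n\<close>.\<close>

lemma Q_in_K: "Q h \<in> K"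
proof (rule KI)
  fix n
  have "(\<lambda>k. E (k + n) h) \<longlonglongrightarrow> Q h"
    by (rule LIMSEQ_ignore_initial_segment[OF E_tendsto_Q])
  moreover have "E (k + n) h \<in> range (V ^^ n)" for k
    unfolding E_def add.commute[of k n] by (simp add: funpow_add)
  ultimately show "Q h \<in> range (V ^^ n)"
    by (rule closed_sequentially[OF
          closed_csubspaceD(4)[OF hilbert_isometry.closed_csubspace_range[OF V_pow(1)]], rotated])
qed

lemma cinner_Q:
  assumes "k \<in> K"
  shows "cinner (Q x) k = cinner x k"
proof -
  have "cinner (E n x) k = cinner x k" for n
  proof -
    obtain u where u: "k = (V ^^ n) u"
      using KD[OF assms] by blast
    have "cinner x ((V ^^ n) u) = cinner ((Va ^^ n) x) u"
      by (metis cinner_V_pow cinner_commute)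
    then show ?thesis
      unfolding E_def u cinner_V_pow Va_pow_V_pow by simp
  qed
  then have "(\<lambda>n. cinner x k) \<longlonglongrightarrow> cinner (Q x) k"
    using tendsto_cinner_left[OF E_tendsto_Q[of x], of k] by simp
  then show ?thesis
    using LIMSEQ_unique tendsto_const by blast
qed

text \<open>The characterisation of \<open>Q\<close> as orthogonal projection onto \<open>K\<close>;
  linearity and commutation of \<open>Q\<close> are checked in this form.\<close>

lemma Q_eqI:
  assumes k: "k \<in> K" and orth: "\<And>u. u \<in> K \<Longrightarrow> cinner (x - k) u = 0"
  shows "Q x = k"
proof -
  define d where "d = Q x - k"
  have d: "d \<in> K"
    unfolding d_def by (rule closed_csubspaceD(5)[OF closed_K Q_in_K k])
  have "cinner d d = cinner (Q x) d - cinner k d"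
    unfolding d_def by (rule cinner_diff_left)
  also have "\<dots> = 0"
    using orth[OF d] by (simp add: cinner_Q[OF d] cinner_diff_left)
  finally show ?thesis
    by (simp add: d_def cinner_self_eq_0)
qed

lemma Q_add: "Q (x + y) = Q x + Q y"
  by (rule Q_eqI) (simp_all add: Q_in_K closed_csubspaceD(2)[OF closed_K] cinner_linear cinner_Q)

lemma Q_scaleC: "Q (c *\<^sub>C x) = c *\<^sub>C Q x"
  by (rule Q_eqI) (simp_all add: Q_in_K closed_csubspaceD(3)[OF closed_K] cinner_linear cinner_Q)

text \<open>Mapping \<open>K\<close> onto itself and preserving inner products, \<open>W\<close>
  also preserves orthogonality to \<open>K\<close>.\<close>

lemma Q_isometry:
  assumes W: "hilbert_isometry W" and WK: "W ` K = K"
  shows "Q (W x) = W (Q x)" "unitary_on K W"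
proof -
  interpret W: hilbert_isometry W by (rule W)
  show "Q (W x) = W (Q x)"
  proof (rule Q_eqI)
    show "W (Q x) \<in> K"
      using WK Q_in_K by blast
    fix u assume "u \<in> K"
    then obtain k where k: "u = W k" "k \<in> K"
      using WK by blast
    then show "cinner (W x - W (Q x)) u = 0"
      by (simp add: W.cinner cinner_diff_left cinner_Q)
  qed
  have "bounded_op K W"
    by (rule bounded_opI[where b = 1]) (use WK in \<open>auto simp: W.add W.scaleC W.norm\<close>)
  then show "unitary_on K W"
    using WK by (simp add: unitary_on_def W.cinner)
qed

lemma V1_V: "V1 (V x) = q *\<^sub>C V (V1 x)" and V2_V: "V2 (V x) = cnj q *\<^sub>C V (V2 x)"
  by (simp_all add: V_apply comm'[of x] comm'[of "V2 x"] V1.scaleC scaleC_scaleC q_cnj)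

lemma V1_V_pow: "V1 ((V ^^ n) x) = q ^ n *\<^sub>C (V ^^ n) (V1 x)"
  by (induction n) (simp_all add: V1_V V.scaleC scaleC_scaleC mult.commute)

lemma V2_V_pow: "V2 ((V ^^ n) x) = cnj q ^ n *\<^sub>C (V ^^ n) (V2 x)"
  by (induction n) (simp_all add: V2_V V.scaleC scaleC_scaleC mult.commute)

lemma range_V_pow_scaleC: "c *\<^sub>C (V ^^ n) x \<in> range (V ^^ n)"
  by (rule closed_csubspaceD(3)[OF hilbert_isometry.closed_csubspace_range[OF V_pow(1)]]) simp

lemma V1_range: "V1 ((V ^^ n) x) \<in> range (V ^^ n)" and V2_range: "V2 ((V ^^ n) x) \<in> range (V ^^ n)"
  unfolding V1_V_pow V2_V_pow by (rule range_V_pow_scaleC)+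

lemma V1_K: "V1 ` K = K"
proof
  show "V1 ` K \<subseteq> K"
    using KD V1_range by (auto intro!: KI) metis
  show "K \<subseteq> V1 ` K"
  proof
    fix k assume k: "k \<in> K"
    \<comment> \<open>Writing \<open>k\<close> with one power of \<open>V\<close> more than needed
      leaves \<open>V2 ((V ^^ n) x)\<close> after cancelling \<open>V1\<close>, and
      \<open>V2\<close> preserves the range of \<open>V ^^ n\<close>.\<close>
    have *: "k = V1 (A1 k) \<and> A1 k \<in> range (V ^^ n)" for n
    proof -
      obtain x where "k = (V ^^ Suc n) x"
        using KD[OF k] by blast
      then have "k = V1 (V2 ((V ^^ n) x))"
        by (simp add: V_apply)
      then show ?thesis
        using V2_range by (simp add: V1.adj_left_inverse)
    qed
    then have "A1 k \<in> K"
      by (intro KI) blast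
    then show "k \<in> V1 ` K"
      using * by (metis imageI)
  qed
qed

lemma V2_K: "V2 ` K = K"
proof
  show "V2 ` K \<subseteq> K"
    using KD V2_range by (auto intro!: KI) metis
  show "K \<subseteq> V2 ` K"
  proof
    fix k assume k: "k \<in> K"
    have *: "k = V2 (A2 k) \<and> A2 k \<in> range (V ^^ n)" for n
    proof -
      obtain x where "k = (V ^^ Suc n) x"
        using KD[OF k] by blast
      \<comment> \<open>The factor \<open>q\<close> from exchanging \<open>V1\<close> and
        \<open>V2\<close> is moved into the argument.\<close>
      then have "k = V2 (V1 ((V ^^ n) (q *\<^sub>C x)))"
        using hilbert_isometry.scaleC[OF V_pow(1)] by (simp add: V_apply comm V1.scaleC V2.scaleC)
      then show ?thesis
        using V1_range by (simp add: V2.adj_left_inverse)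
    qed
    then have "A2 k \<in> K"
      by (intro KI) blast
    then show "k \<in> V2 ` K"
      using * by (metis imageI)
  qed
qed

lemma tuple: "bcl_tuple q F K bcl_P U V1 V2"
  unfolding bcl_tuple_def q_commuting_on_def
  using closed_F closed_K projection_bcl_P unitary_U comm
    Q_isometry(2)[OF V1.hilbert_isometry_axioms V1_K] Q_isometry(2)[OF V2.hilbert_isometry_axioms V2_K]
  by blast

sublocale model: bcl_data q F K bcl_P U V1 V2
  using q tuple by unfold_locales

subsection \<open>The unitary equivalence\<close>

definition coeff where "coeff h n = col ((Va ^^ n) h)"

definition tau :: "'a \<Rightarrow> (complex \<Rightarrow> 'a \<times> 'a) \<times> 'a" where
  "tau h = ((\<lambda>z. if z \<in> ball 0 1 then \<Sum>n. z ^ n *\<^sub>C coeff h n else 0), Q h)"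

lemma coeff_in_F: "coeff h n \<in> F"
  by (simp add: coeff_def col_in_F)

text \<open>The terms telescope by \<open>cinner_col\<close>, and the sequence \<open>c\<close>
  tends to \<open>cinner (Q x) (Q y)\<close> because \<open>c n\<close> is also
  \<open>cinner (E n x) y\<close>.\<close>

lemma coeff_sums: "(\<lambda>n. cinner (coeff x n) (coeff y n)) sums (cinner x y - cinner (Q x) (Q y))"
proof -
  define c where "c n = cinner ((Va ^^ n) x) ((Va ^^ n) y)" for n
  have "c = (\<lambda>n. cinner (E n x) y)"
    by (simp add: fun_eq_iff c_def E_def cinner_V_pow)
  moreover have "cinner (Q x) y = cinner (Q x) (Q y)"
    using cinner_Q[OF Q_in_K, of y x] by (metis cinner_commute)
  ultimately have "c \<longlonglongrightarrow> cinner (Q x) (Q y)"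
    using tendsto_cinner_left[OF E_tendsto_Q[of x], of y] by simp
  from telescope_sums'[OF this] show ?thesis
    by (simp add: c_def coeff_def cinner_col)
qed

lemma coeff_summable: "summable (\<lambda>n. (norm (coeff h n))\<^sup>2)"
  using sums_summable[OF sums_Re[OF coeff_sums[of h h]]] by (simp add: cinner_self)

lemma tau_power_series: "power_series_on_disk (coeff h) (fst (tau h))"
  using power_series_on_disk_exists[OF coeff_summable] by (simp add: tau_def)

lemma tau_outside: "z \<notin> ball 0 1 \<Longrightarrow> fst (tau h) z = 0"
  by (simp add: tau_def)

lemma snd_tau: "snd (tau h) = Q h"
  by (simp add: tau_def)

lemma tau_eqI:
  assumes "power_series_on_disk (coeff h) f" "\<And>z. z \<notin> ball 0 1 \<Longrightarrow> f z = 0"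
  shows "fst (tau h) = f"
  using tau_power_series tau_outside assms by (rule power_series_on_disk_eqI)

lemma is_bcl_tau: "is_bcl_tau V1 V2 tau"
proof -
  have "A2 \<circ> A1 = Va"
    by (simp add: fun_eq_iff Va_apply)
  moreover have "coeff h = (\<lambda>n. (D1 ((Va ^^ n) h), D2 (A1 ((Va ^^ n) h))))" for h
    by (simp add: fun_eq_iff coeff_def col_def)
  ultimately show ?thesis
    using tau_power_series E_tendsto_Q
    by (simp add: is_bcl_tau_def snd_tau E_def Let_def flip: V_def)
qed

lemma Va_pow_add: "(Va ^^ n) (x + y) = (Va ^^ n) x + (Va ^^ n) y"
  by (induction n) (simp_all add: V.adj_add)

lemma coeff_add: "coeff (x + y) n = coeff x n + coeff y n"
  and coeff_scaleC: "coeff (c *\<^sub>C x) n = c *\<^sub>C coeff x n"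
  by (simp_all add: coeff_def Va_pow_add Va_pow_scaleC col_add col_scaleC)

text \<open>Continuity allows coefficients of an infinite sum to be computed term by term in
  \<open>tau_surj\<close>; the bound comes from \<open>cinner_col\<close>.\<close>

lemma bounded_linear_coeff: "bounded_linear (\<lambda>h. coeff h n)"
proof (rule bounded_linear_intro)
  show "coeff (r *\<^sub>R x) n = r *\<^sub>R coeff x n" for r x
    using coeff_scaleC[of "complex_of_real r" x n] by (simp only: scaleC_of_real)
  show "norm (coeff x n) \<le> norm x * 1" for x
  proof -
    have le: "norm ((Va ^^ n) x) \<le> norm x"
      using hilbert_isometry.norm_adj_le[OF V_pow(1), of n x] by (simp only: V_pow(2))
    have "complex_of_real ((norm (col y))\<^sup>2) = complex_of_real ((norm y)\<^sup>2 - (norm (Va y))\<^sup>2)" for y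
      using cinner_col[of y y] by (simp add: cinner_self)
    then have sq: "(norm (col y))\<^sup>2 = (norm y)\<^sup>2 - (norm (Va y))\<^sup>2" for y
      by (simp only: of_real_eq_iff)
    have "norm (col y) \<le> norm y" for y
      by (rule power2_le_imp_le) (simp_all add: sq)
    then show ?thesis
      using le unfolding coeff_def mult_1_right by (rule order_trans)
  qed
qed (rule coeff_add)

text \<open>For \<open>n < m\<close> a surplus \<open>Va\<close> annihilates \<open>lift v\<close>;
  for \<open>n > m\<close> a surplus \<open>V\<close> is annihilated by \<open>col\<close>.\<close>

lemma coeff_V_pow_lift:
  assumes v: "v \<in> F"
  shows "coeff ((V ^^ n) (lift v)) m = (if n = m then v else 0)"
proof (cases n m rule: linorder_cases)
  case less
  then obtain k where m: "m = Suc k + n"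
    by (metis add.commute less_imp_Suc_add add_Suc_right)
  have "(Va ^^ m) ((V ^^ n) (lift v)) = (Va ^^ k) 0"
    unfolding m funpow_add o_apply Va_pow_V_pow by (simp only: funpow_Suc_right o_apply Va_lift[OF v])
  moreover have "(Va ^^ k) 0 = 0"
    by (induction k) (simp_all add: V.adj_zero)
  ultimately show ?thesis
    using less col_scaleC[of 0 0] by (simp add: coeff_def)
next
  case equal
  then show ?thesis
    by (simp add: coeff_def Va_pow_V_pow col_lift[OF v])
next
  case greater
  then obtain k where n: "n = m + Suc k"
    by (metis add_Suc_right less_imp_Suc_add)
  have "(Va ^^ m) ((V ^^ n) (lift v)) = V ((V ^^ k) (lift v))"
    unfolding n funpow_add o_apply Va_pow_V_pow by simp
  then show ?thesis
    using greater by (simp add: coeff_def col_V)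
qed

text \<open>An element of \<open>K\<close> can be written with \<open>Suc n\<close> factors
  \<open>V\<close>; one of them survives \<open>Va ^^ n\<close> and is annihilated by
  \<open>col\<close>.\<close>

lemma coeff_K:
  assumes "k \<in> K"
  shows "coeff k n = 0"
proof -
  obtain u where "k = (V ^^ Suc n) u"
    using KD[OF assms] by blast
  then have "(Va ^^ n) k = V u"
    by (simp only: funpow_Suc_right o_apply Va_pow_V_pow)
  then show ?thesis
    by (simp add: coeff_def col_V)
qed

lemma cinner_V_pow_lift_K:
  assumes v: "v \<in> F" and k: "k \<in> K"
  shows "cinner ((V ^^ n) (lift v)) k = 0"
proof -
  obtain u where "k = (V ^^ Suc n) u"
    using KD[OF k] by blast
  then have "(Va ^^ n) k = V u"
    by (simp only: funpow_Suc_right o_apply Va_pow_V_pow)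
  then show ?thesis
    using V.cinner_adj_left[of "lift v" u] by (simp add: cinner_V_pow Va_lift[OF v])
qed

lemma tau_surj:
  assumes f: "f \<in> hardy F" and k: "k \<in> K"
  shows "(f, k) \<in> range tau"
proof -
  define a where "a = taylor_coeff f"
  note hf = hardyD[OF closed_F f, folded a_def]
  \<comment> \<open>A term of the Wold decomposition: the image under \<open>V ^^ n\<close> of a
    vector in the kernel of \<open>Va\<close>. Different terms are orthogonal.\<close>
  define b where "b n = (V ^^ n) (lift (a n))" for n
  have "summable b"
  proof (rule summable_orthogonal)
    fix m n :: nat assume "m < n"
    then obtain j where n: "n = m + Suc j"
      by (metis add_Suc_right less_imp_Suc_add)
    have "(Va ^^ m) (b n) = V ((V ^^ j) (lift (a n)))"
      unfolding b_def n funpow_add o_apply Va_pow_V_pow by simp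
    then show "cinner (b m) (b n) = 0"
      using V.cinner_adj_left[of "lift (a m)" "(V ^^ j) (lift (a n))"]
      by (simp add: b_def[of m] cinner_V_pow Va_lift[OF hf(4)])
  next
    have "norm (b n) = norm (a n)" for n
      using norm_eq_of_cinner[OF cinner_lift[OF hf(4) hf(4)]]
      by (simp add: b_def hilbert_isometry.norm[OF V_pow(1)])
    then show "summable (\<lambda>n. (norm (b n))\<^sup>2)"
      using hf(5) by simp
  qed
  then have b: "b sums suminf b"
    by (rule summable_sums)
  define h where "h = suminf b + k"
  have "coeff h = a"
  proof
    fix m
    have "(\<lambda>n. if n = m then a n else 0) sums coeff (suminf b) m"
      using bounded_linear.sums[OF bounded_linear_coeff b, of m]
      unfolding b_def coeff_V_pow_lift[OF hf(4)] .
    moreover have "(\<lambda>n. if n = m then a n else 0) sums a m"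
      by (rule sums_single)
    ultimately have "coeff (suminf b) m = a m"
      by (rule sums_unique2)
    then show "coeff h m = a m"
      by (simp add: h_def coeff_add coeff_K[OF k])
  qed
  then have "fst (tau h) = f"
    using hf by (intro tau_eqI) simp_all
  moreover have "Q h = k"
  proof (rule Q_eqI[OF k])
    fix u assume u: "u \<in> K"
    have "(\<lambda>n. 0) sums cinner (suminf b) u"
      using bounded_linear.sums[OF bounded_linear_cinner_left b, of u]
      unfolding b_def cinner_V_pow_lift_K[OF hf(4) u] .
    then show "cinner (h - k) u = 0"
      using sums_unique2[OF sums_zero] by (simp add: h_def)
  qed
  ultimately have "tau h = (f, k)"
    by (simp add: prod_eq_iff snd_tau)
  then show ?thesis
    by (metis rangeI)
qed

lemma model_unitary_tau: "model_unitary F K tau"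
  unfolding model_unitary_def
proof (intro conjI allI)
  show "range tau = hardy F \<times> K"
  proof
    have "tau x \<in> hardy F \<times> K" for x
      using hardyI[OF tau_outside coeff_in_F coeff_summable tau_power_series] Q_in_K
      by (simp add: mem_Times_iff snd_tau)
    then show "range tau \<subseteq> hardy F \<times> K"
      by blast
    show "hardy F \<times> K \<subseteq> range tau"
      using tau_surj by auto
  qed
next
  fix x y
  have "fst (tau (x + y)) = (\<lambda>z. fst (tau x) z + fst (tau y) z)"
    using tau_power_series[of x] tau_power_series[of y] tau_outside
    by (intro tau_eqI) (simp_all add: power_series_on_disk_def coeff_add scaleC_add_right sums_add)
  then show "tau (x + y) = (\<lambda>z. fst (tau x) z + fst (tau y) z, snd (tau x) + snd (tau y))"
    by (simp add: prod_eq_iff snd_tau Q_add)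
next
  fix c x
  have "fst (tau (c *\<^sub>C x)) = (\<lambda>z. c *\<^sub>C fst (tau x) z)"
  proof (rule tau_eqI)
    show "power_series_on_disk (coeff (c *\<^sub>C x)) (\<lambda>z. c *\<^sub>C fst (tau x) z)"
      unfolding power_series_on_disk_def
    proof
      fix z :: complex assume "z \<in> ball 0 1"
      then have "(\<lambda>n. z ^ n *\<^sub>C coeff x n) sums fst (tau x) z"
        using tau_power_series[of x] by (auto simp: power_series_on_disk_def)
      from bounded_linear.sums[OF bounded_linear_scaleC[of c] this]
      show "(\<lambda>n. z ^ n *\<^sub>C coeff (c *\<^sub>C x) n) sums (c *\<^sub>C fst (tau x) z)"
        by (simp add: coeff_scaleC scaleC_scaleC mult.commute)
    qed
  qed (simp add: tau_outside)
  then show "tau (c *\<^sub>C x) = (\<lambda>z. c *\<^sub>C fst (tau x) z, c *\<^sub>C snd (tau x))"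
    by (simp add: prod_eq_iff snd_tau Q_scaleC)
next
  fix x y
  have "hardy_inner (fst (tau x)) (fst (tau y)) = cinner x y - cinner (Q x) (Q y)"
    unfolding hardy_inner_def taylor_coeff_eqI[OF tau_power_series]
    by (rule sums_unique[OF coeff_sums, symmetric])
  then show "hardy_inner (fst (tau x)) (fst (tau y)) + cinner (snd (tau x)) (snd (tau y)) = cinner x y"
    by (simp add: snd_tau)
qed

text \<open>Reduces an intertwining relation to Taylor coefficients. Off the disk both sides vanish,
  since the rotation preserves the complement of the disk and \<open>A\<close>, \<open>B\<close> fix
  0.\<close>

lemma tau_shift_op:
  assumes p: "cmod p = 1" and A: "bounded_op F A" and B: "bounded_op F B"
    and coeff: "\<And>n. coeff g n = shift_coeff p A B (coeff h) n"
  shows "fst (tau g) = shift_op p A B (fst (tau h))"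
proof (rule tau_eqI)
  have "coeff g = shift_coeff p A B (coeff h)"
    using coeff by blast
  then show "power_series_on_disk (coeff g) (shift_op p A B (fst (tau h)))"
    using shift_op_power_series[OF p closed_F A B coeff_in_F tau_power_series, of h] by simp
  show "shift_op p A B (fst (tau h)) z = 0" if "z \<notin> ball 0 1" for z
  proof -
    have "p * z \<notin> ball 0 1"
      using that p by (simp add: norm_mult)
    then show ?thesis
      using bounded_op_0[OF closed_F A] bounded_op_0[OF closed_F B]
      by (simp add: shift_op_def tau_outside)
  qed
qed

section \<open>Intertwining relations, coefficient by coefficient\<close>

lemma P_rot: "bcl_P (rot h) = (D1 (A2 h), 0)" "perp bcl_P (rot h) = (0, D2 h)"
  and P_col: "bcl_P (col h) = (D1 h, 0)" "perp bcl_P (col h) = (0, D2 (A1 h))"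
  by (simp_all add: bcl_P_def perp_def rot_def col_def)

lemma coeff_V1:
  "coeff (V1 h) n = shift_coeff q (\<lambda>v. perp bcl_P (U v)) (\<lambda>v. bcl_P (U v)) (coeff h) n"
proof (cases n)
  case 0
  then show ?thesis
    by (simp add: coeff_def shift_coeff_def U_col P_rot)
      (simp add: col_def V1.defect_adj_range V1.adj_left_inverse)
next
  case (Suc m)
  define g where "g = (Va ^^ m) h"
  have "coeff (V1 h) n = q ^ m *\<^sub>C col (A2 g)"
    unfolding coeff_def Suc Va_pow_V1 col_scaleC g_def ..
  \<comment> \<open>\<open>adj_comm\<close> puts one further \<open>q\<close> on the second
    component, completing the power \<open>q ^ n\<close> of the unshifted term in
    \<open>shift_coeff\<close>.\<close>
  also have "\<dots> = q ^ m *\<^sub>C (D1 (A2 g), q *\<^sub>C D2 (Va g))"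
    by (simp add: col_def adj_comm V2.defect_adj_scaleC)
  finally show ?thesis
    by (simp add: Suc shift_coeff_def coeff_def U_col P_rot scaleC_prod_def scaleC_scaleC mult.commute
        flip: g_def)
qed

text \<open>\<open>adj_on F U\<close> is available only as the inverse of \<open>U\<close>. The
  identity is therefore proved after applying \<open>U\<close>, where \<open>U_col\<close> turns
  \<open>col\<close> into \<open>rot\<close>, and then pulled back by \<open>Ua_U\<close>.\<close>

lemma coeff_V2:
  "coeff (V2 h) n = shift_coeff (cnj q) (\<lambda>v. adj_on F U (bcl_P v))
     (\<lambda>v. cnj q *\<^sub>C adj_on F U (perp bcl_P v)) (coeff h) n"
proof -
  note simps = model.linear model.mem coeff_in_F col_in_F
  have "U (coeff (V2 h) n) = cnj q ^ n *\<^sub>C bcl_P (coeff h n) +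
      (case n of 0 \<Rightarrow> 0 | Suc m \<Rightarrow> cnj q ^ n *\<^sub>C perp bcl_P (coeff h m))"
  proof (cases n)
    case 0
    then show ?thesis
      by (simp add: coeff_def U_col P_col)
        (simp add: rot_def V2.defect_adj_range V2.adj_left_inverse)
  next
    case (Suc m)
    define g where "g = (Va ^^ m) h"
    have "coeff (V2 h) n = cnj q ^ n *\<^sub>C col (A1 g)"
      unfolding coeff_def Suc Va_pow_V2 col_scaleC g_def ..
    then have "U (coeff (V2 h) n) = cnj q ^ n *\<^sub>C rot (A1 g)"
      by (simp only: model.linear(5)[OF col_in_F] U_col)
    then show ?thesis
      by (simp add: Suc coeff_def P_col scaleC_prod_def rot_def flip: g_def Va_apply)
  qed
  then have "coeff (V2 h) n = model.Ua (cnj q ^ n *\<^sub>C bcl_P (coeff h n) +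
      (case n of 0 \<Rightarrow> 0 | Suc m \<Rightarrow> cnj q ^ n *\<^sub>C perp bcl_P (coeff h m)))"
    using model.Ua_U[OF coeff_in_F] by metis
  then show ?thesis
    unfolding model.Ua_def[symmetric]
    by (cases n) (simp_all add: shift_coeff_def simps scaleC_scaleC mult.commute)
qed

lemma bcl1_model_tau: "bcl1_model q V1 V2 F K bcl_P U V1 V2 tau"
proof -
  note comp = bounded_op_compose[unfolded o_def]
  have "fst (tau (V1 h)) = shift_op q (\<lambda>v. perp bcl_P (U v)) (\<lambda>v. bcl_P (U v)) (fst (tau h))" for h
    by (intro tau_shift_op q comp[OF model.bounded_perp model.bounded_U]
        comp[OF model.bounded_P model.bounded_U] coeff_V1)
  moreover have "fst (tau (V2 h)) = shift_op (cnj q) (\<lambda>v. adj_on F U (bcl_P v))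
      (\<lambda>v. cnj q *\<^sub>C adj_on F U (perp bcl_P v)) (fst (tau h))" for h
  proof (rule tau_shift_op)
    show "bounded_op F (\<lambda>v. adj_on F U (bcl_P v))"
      using comp[OF model.bounded_Ua model.bounded_P] by (simp only: model.Ua_def)
    show "bounded_op F (\<lambda>v. cnj q *\<^sub>C adj_on F U (perp bcl_P v))"
      using bounded_op_scaleC[OF closed_F comp[OF model.bounded_Ua model.bounded_perp], of "cnj q"]
      by (simp only: model.Ua_def)
  qed (simp_all add: q coeff_V2)
  ultimately show ?thesis
    using tuple model_unitary_tau Q_isometry(1)[OF V1.hilbert_isometry_axioms V1_K]
      Q_isometry(1)[OF V2.hilbert_isometry_axioms V2_K]
    by (simp add: bcl1_model_iff prod_eq_iff snd_tau)
qed

end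

section \<open>The equivalences and the explicit model data\<close>

theorem theorem2p2:
  fixes q :: complex and V1 V2 :: "'a::chilbert_space \<Rightarrow> 'a"
  assumes "cmod q = 1" and "bounded_op UNIV V1" and "bounded_op UNIV V2"
  shows
    "(q_isometric_pair q V1 V2 \<longleftrightarrow>
        (\<exists>(F :: ('a \<times> 'a) set) (K :: 'a set) P U W1 W2 \<tau>. bcl1_model q V1 V2 F K P U W1 W2 \<tau>)) \<and>
     (q_isometric_pair q V1 V2 \<longleftrightarrow>
        (\<exists>(F :: ('a \<times> 'a) set) (K :: 'a set) P U W1 W2 \<tau>. bcl2_model q V1 V2 F K P U W1 W2 \<tau>)) \<and>
     ((\<exists>(F :: 'f::chilbert_space set) (K :: 'k::chilbert_space set) P U W1 W2 \<tau>.
          bcl1_model q V1 V2 F K P U W1 W2 \<tau> \<or> bcl2_model q V1 V2 F K P U W1 W2 \<tau>) \<longrightarrow>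
        q_isometric_pair q V1 V2) \<and>
     (q_isometric_pair q V1 V2 \<longrightarrow>
        (let F = bcl_F V1 V2; K = bcl_K V1 V2; P = bcl_P in
          \<exists>U \<tau>. is_bcl_U V1 V2 U \<and> is_bcl_tau V1 V2 \<tau> \<and>
            bcl1_model q V1 V2 F K P U V1 V2 \<tau> \<and>
            bcl2_model q V1 V2 F K P (adj_on F U) V1 V2 (map_prod (id \<otimes>\<^sub>H U) id \<circ> \<tau>) \<and>
            bcl2_model q V1 V2 F K (adj_on F U \<circ> P \<circ> U) (adj_on F U) V1 V2 \<tau>))"
proof -
  note converse = q_isometric_pair_of_model[OF assms]
  \<comment> \<open>Every existence claim follows from this one tuple; the opposite directions are
    covered by \<open>converse\<close>.\<close>
  have explicit: "\<exists>U \<tau>. is_bcl_U V1 V2 U \<and> is_bcl_tau V1 V2 \<tau> \<and>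
      bcl1_model q V1 V2 (bcl_F V1 V2) (bcl_K V1 V2) bcl_P U V1 V2 \<tau> \<and>
      bcl2_model q V1 V2 (bcl_F V1 V2) (bcl_K V1 V2) bcl_P (adj_on (bcl_F V1 V2) U) V1 V2
        (map_prod (id \<otimes>\<^sub>H U) id \<circ> \<tau>) \<and>
      bcl2_model q V1 V2 (bcl_F V1 V2) (bcl_K V1 V2) (adj_on (bcl_F V1 V2) U \<circ> bcl_P \<circ> U)
        (adj_on (bcl_F V1 V2) U) V1 V2 \<tau>"
    if "q_isometric_pair q V1 V2"
  proof -
    interpret q_isometries q V1 V2
      using assms(1) that by unfold_locales
    show ?thesis
      using is_bcl_U is_bcl_tau bcl1_model_tau model.bcl1_imp_bcl2[OF bcl1_model_tau]
        model.bcl1_imp_bcl2_rotated[OF bcl1_model_tau]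
      by blast
  qed
  show ?thesis
    unfolding Let_def
  proof (intro conjI iffI impI)
    show "q_isometric_pair q V1 V2 \<Longrightarrow> \<exists>(F :: ('a \<times> 'a) set) (K :: 'a set) P U W1 W2 \<tau>.
        bcl1_model q V1 V2 F K P U W1 W2 \<tau>"
      using explicit by blast
    show "q_isometric_pair q V1 V2 \<Longrightarrow> \<exists>(F :: ('a \<times> 'a) set) (K :: 'a set) P U W1 W2 \<tau>.
        bcl2_model q V1 V2 F K P U W1 W2 \<tau>"
      using explicit by blast
  qed (use explicit converse in blast)+
qed

end
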